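(* Let $n>2$ and let $\mathrm{SO}(n)$ be the special orthogonal group with the Riemannian metric inherited from its embedding in $\mathbb R^{n\times n}$ with the Frobenius inner product. For every $p\in\mathrm{SO}(n)$, every unit vector $v\in T_p\mathrm{SO}(n)$, all $w_1,w_2\in T_p\mathrm{SO}(n)$, and every $0<r<2\sqrt2\,\pi$, $$\|(\nabla\mathrm{d}\exp_p)_{rv}(w_1,w_2)\|\le\frac r3\,\|w_1\|\,\|w_2\|.$$
   Context: $\exp_p$ is the Riemannian exponential map. Hessian of the exponential map: $\mathrm{d}\exp_p$ is viewed as a section of the bundle $T_p^*M\otimes\exp_p^*(TM)$ over $T_pM$ (here $M=\mathrm{SO}(n)$), with the connection induced by the flat connection $\nabla^{\mathrm{flat}}$ on $T_pM$ and the pullback of the Levi-Civita connection. For vector fields $\overline W_1,\overline W_2$ on an open subset of $T_pM$, $(\nabla\mathrm{d}\exp_p)(\overline W_1,\overline W_2)=\nabla_{\overline W_1}(\mathrm{d}\exp_p(\overline W_2))-\mathrm{d}\exp_p(\nabla^{\mathrm{flat}}_{\overline W_1}\overline W_2)$, where the first $\nabla$ on the right is the pullback connection along $\exp_p$. At each $u\in T_pM$ this is a symmetric bilinear map $(\nabla\mathrm{d}\exp_p)_u:T_pM\times T_pM\to T_{\exp_p(u)}M$. *)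

theory Defs
  imports "HOL-Analysis.Analysis"
begin

section \<open>Riemannian submanifolds of a Euclidean space\<close>

text \<open>A manifold is given as a subset \<open>M\<close> of a Euclidean space and carries the metric
  inherited from the inner product of that space.\<close>

definition tangent_space :: "'a::euclidean_space set \<Rightarrow> 'a \<Rightarrow> 'a set"
  where "tangent_space M p =
    {v. \<exists>\<gamma>::real \<Rightarrow> 'a. (\<forall>t. \<gamma> t \<in> M) \<and> \<gamma> 0 = p \<and> (\<gamma> has_vector_derivative v) (at 0)}"

definition orth_proj :: "'a::euclidean_space set \<Rightarrow> 'a \<Rightarrow> 'a"
  where "orth_proj S x = (THE y. y \<in> S \<and> (\<forall>z\<in>S. (x - y) \<bullet> z = 0))"

text \<open>Pullback of the Levi-Civita connection of \<open>M\<close> along a map \<open>f\<close> from \<open>N\<close> to \<open>M\<close>, applied to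
  a section \<open>s\<close> along \<open>f\<close> (so \<open>s x \<in> tangent_space M (f x)\<close>), at the point \<open>x\<close> in the direction
  \<open>w\<close>. For the induced metric this is the tangential part of the ambient derivative. The Levi-Civita
  connection itself is the case of the identity map; for the rotation group its defining
  properties (metric, torsion-free) and the pullback rule are proved below.\<close>

definition pullback_LC ::
  "'a::euclidean_space set \<Rightarrow> 'b::euclidean_space set \<Rightarrow> ('b \<Rightarrow> 'a) \<Rightarrow> ('b \<Rightarrow> 'a) \<Rightarrow> 'b \<Rightarrow> 'b \<Rightarrow> 'a"
  where "pullback_LC M N f s x w =
    orth_proj (tangent_space M (f x)) (frechet_derivative s (at x within N) w)"

abbreviation LC :: "'a::euclidean_space set \<Rightarrow> ('a \<Rightarrow> 'a) \<Rightarrow> 'a \<Rightarrow> 'a \<Rightarrow> 'a"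
  where "LC M X p v \<equiv> pullback_LC M M (\<lambda>x. x) X p v"

definition geodesic :: "'a::euclidean_space set \<Rightarrow> (real \<Rightarrow> 'a) \<Rightarrow> bool"
  where "geodesic M \<gamma> \<longleftrightarrow> (\<forall>t. \<gamma> t \<in> M) \<and>
    (\<exists>\<gamma>'. \<forall>t. (\<gamma> has_vector_derivative \<gamma>' t) (at t) \<and> \<gamma>' differentiable at t
       \<and> pullback_LC M UNIV \<gamma> \<gamma>' t 1 = 0)"

text \<open>Geodesics are required to be defined on the whole real line, so this is the exponential map of
  a complete \<open>M\<close>.\<close>

definition riem_exp :: "'a::euclidean_space set \<Rightarrow> 'a \<Rightarrow> 'a \<Rightarrow> 'a"
  where "riem_exp M p v =
    (THE q. \<exists>\<gamma>. geodesic M \<gamma> \<and> \<gamma> 0 = p \<and> (\<gamma> has_vector_derivative v) (at 0) \<and> \<gamma> 1 = q)"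

definition d_exp :: "'a::euclidean_space set \<Rightarrow> 'a \<Rightarrow> 'a \<Rightarrow> 'a \<Rightarrow> 'a"
  where "d_exp M p u = frechet_derivative (riem_exp M p) (at u within tangent_space M p)"

definition hess_exp_fields ::
  "'a::euclidean_space set \<Rightarrow> 'a \<Rightarrow> ('a \<Rightarrow> 'a) \<Rightarrow> ('a \<Rightarrow> 'a) \<Rightarrow> 'a \<Rightarrow> 'a"
  where "hess_exp_fields M p W1 W2 u =
    pullback_LC M (tangent_space M p) (riem_exp M p) (\<lambda>x. d_exp M p x (W2 x)) u (W1 u)
    - d_exp M p u (frechet_derivative W2 (at u within tangent_space M p) (W1 u))"

text \<open>The value of the tensor on a pair of tangent vectors at \<open>u\<close> is the common value on all
  vector fields, on open neighbourhoods \<open>U\<close> of \<open>u\<close>, that extend the two vectors.\<close>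

definition hess_exp :: "'a::euclidean_space set \<Rightarrow> 'a \<Rightarrow> 'a \<Rightarrow> 'a \<Rightarrow> 'a \<Rightarrow> 'a"
  where "hess_exp M p u w1 w2 =
    (THE h. \<forall>U W1 W2. openin (top_of_set (tangent_space M p)) U \<and> u \<in> U
        \<and> W1 \<in> U \<rightarrow> tangent_space M p \<and> W2 \<in> U \<rightarrow> tangent_space M p
        \<and> W1 differentiable_on U \<and> W2 differentiable_on U \<and> W1 u = w1 \<and> W2 u = w2
      \<longrightarrow> hess_exp_fields M p W1 W2 u = h)"

lemma frechet_derivative_tangent:
  assumes f: "(f has_derivative D) (at p within M)" and v: "v \<in> tangent_space M p"
  shows "frechet_derivative f (at p within M) v = D v"
proof -
  obtain \<gamma> :: "real \<Rightarrow> 'a" where \<gamma>: "\<forall>t. \<gamma> t \<in> M" "\<gamma> 0 = p" "(\<gamma> has_vector_derivative v) (at 0)"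
    using v by (auto simp: tangent_space_def)
  have *: "((f \<circ> \<gamma>) has_vector_derivative E v) (at 0)"
    if E: "(f has_derivative E) (at p within M)" for E
  proof -
    have "(f has_derivative E) (at (\<gamma> 0) within range \<gamma>)"
      by (rule has_derivative_subset[of _ _ _ M]) (use E \<gamma> in auto)
    from diff_chain_within[OF \<gamma>(3)[unfolded has_vector_derivative_def] this]
    show ?thesis
      using has_derivative_bounded_linear[OF E]
      by (simp add: has_vector_derivative_def o_def bounded_linear.linear linear_cmul)
  qed
  have "(f has_derivative frechet_derivative f (at p within M)) (at p within M)"
    using f frechet_derivative_works differentiableI by blast
  from *[OF this] *[OF f] show ?thesis
    by (rule vector_derivative_unique_at)
qed

lemma tangent_space_map:
  assumes f: "(f has_derivative f') (at x within N)" "f \<in> N \<rightarrow> M" and w: "w \<in> tangent_space N x"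
  shows "f' w \<in> tangent_space M (f x)"
proof -
  obtain \<gamma> :: "real \<Rightarrow> 'a" where \<gamma>: "\<forall>t. \<gamma> t \<in> N" "\<gamma> 0 = x" "(\<gamma> has_vector_derivative w) (at 0)"
    using w by (auto simp: tangent_space_def)
  have "(f has_derivative f') (at (\<gamma> 0) within range \<gamma>)"
    by (rule has_derivative_subset[of _ _ _ N]) (use f(1) \<gamma> in auto)
  from diff_chain_within[OF \<gamma>(3)[unfolded has_vector_derivative_def] this]
  have "((f \<circ> \<gamma>) has_vector_derivative f' w) (at 0)"
    using has_derivative_bounded_linear[OF f(1)]
    by (simp add: has_vector_derivative_def o_def bounded_linear.linear linear_cmul)
  then show ?thesis
    unfolding tangent_space_def using \<gamma> f(2) by (intro CollectI exI[of _ "f \<circ> \<gamma>"]) auto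
qed

lemma
  assumes S: "subspace (S :: 'a::euclidean_space set)"
  shows orth_proj_in: "orth_proj S x \<in> S"
    and orth_proj_inner: "z \<in> S \<Longrightarrow> orth_proj S x \<bullet> z = x \<bullet> z"
    and orth_proj_eqI: "y \<in> S \<Longrightarrow> (\<And>z. z \<in> S \<Longrightarrow> y \<bullet> z = x \<bullet> z) \<Longrightarrow> orth_proj S x = y"
proof -
  obtain y w where yw: "y \<in> span S" "\<And>w'. w' \<in> span S \<Longrightarrow> orthogonal w w'" "x = y + w"
    by (rule orthogonal_subspace_decomp_exists[of S x]) blast
  have y: "y \<in> S" "\<forall>z\<in>S. (x - y) \<bullet> z = 0"
    using yw S by (auto simp: orthogonal_def span_eq_iff[THEN iffD2])
  have uniq: "b = a" if a: "a \<in> S" "\<forall>z\<in>S. (x - a) \<bullet> z = 0" and b: "b \<in> S" "\<forall>z\<in>S. (x - b) \<bullet> z = 0" for a b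
  proof -
    have "b - a \<in> S" using S a b by (simp add: subspace_diff)
    then have "(x - a) \<bullet> (b - a) - (x - b) \<bullet> (b - a) = 0" using a b by simp
    then have "(b - a) \<bullet> (b - a) = 0" by (simp add: inner_diff_left)
    then show ?thesis by simp
  qed
  have P: "orth_proj S x = a" if "a \<in> S" "\<forall>z\<in>S. (x - a) \<bullet> z = 0" for a
    unfolding orth_proj_def using that uniq by (intro the_equality) auto
  show "orth_proj S x \<in> S" using P[OF y] y by simp
  show "z \<in> S \<Longrightarrow> orth_proj S x \<bullet> z = x \<bullet> z" using P[OF y] y by (simp add: inner_diff_left)
  show "y \<in> S \<Longrightarrow> (\<And>z. z \<in> S \<Longrightarrow> y \<bullet> z = x \<bullet> z) \<Longrightarrow> orth_proj S x = y" for y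
    using P[of y] by (simp add: inner_diff_left)
qed


section \<open>The special orthogonal group\<close>

text \<open>The inner product and norm of the type \<open>real ^ 'n ^ 'n\<close> are those of Frobenius.\<close>

definition SO :: "(real ^ 'n ^ 'n) set"
  where "SO = {A. rotation_matrix A}"

lemma bounded_bilinear_matrix_mult:
  "bounded_bilinear ((**) :: real ^ 'n ^ 'n \<Rightarrow> real ^ 'n ^ 'n \<Rightarrow> real ^ 'n ^ 'n)"
  unfolding bilinear_conv_bounded_bilinear[symmetric] bilinear_def
  by (auto intro!: linearI simp: matrix_matrix_mult_def vec_eq_iff algebra_simps sum.distrib sum_distrib_left)

lemma bounded_linear_transpose: "bounded_linear (transpose :: real ^ 'n ^ 'n \<Rightarrow> real ^ 'n ^ 'n)"
  unfolding linear_conv_bounded_linear[symmetric]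
  by (auto intro!: linearI simp: transpose_def vec_eq_iff)

lemmas mm_FDERIV = bounded_bilinear.FDERIV[OF bounded_bilinear_matrix_mult]
  and mm_add_left = bounded_bilinear.add_left[OF bounded_bilinear_matrix_mult]
  and mm_add_right = bounded_bilinear.add_right[OF bounded_bilinear_matrix_mult]
  and mm_diff_left = bounded_bilinear.diff_left[OF bounded_bilinear_matrix_mult]
  and mm_diff_right = bounded_bilinear.diff_right[OF bounded_bilinear_matrix_mult]
  and mm_has_vector_derivative = bounded_bilinear.has_vector_derivative[OF bounded_bilinear_matrix_mult]
  and mm_scaleR_left = bounded_bilinear.scaleR_left[OF bounded_bilinear_matrix_mult]
  and mm_scaleR_right = bounded_bilinear.scaleR_right[OF bounded_bilinear_matrix_mult]
  and mm_tendsto = bounded_bilinear.tendsto[OF bounded_bilinear_matrix_mult]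
  and mm_zero_left = bounded_bilinear.zero_left[OF bounded_bilinear_matrix_mult]
  and mm_zero_right = bounded_bilinear.zero_right[OF bounded_bilinear_matrix_mult]

lemmas tr_add = linear_add[OF bounded_linear.linear[OF bounded_linear_transpose]]
  and tr_diff = linear_diff[OF bounded_linear.linear[OF bounded_linear_transpose]]
  and tr_has_derivative = bounded_linear.has_derivative[OF bounded_linear_transpose]
  and tr_has_vector_derivative = bounded_linear.has_vector_derivative[OF bounded_linear_transpose]
  and tr_scaleR = linear_cmul[OF bounded_linear.linear[OF bounded_linear_transpose]]
  and tr_zero = linear_0[OF bounded_linear.linear[OF bounded_linear_transpose]]

lemma SO_iff: "A \<in> SO \<longleftrightarrow> transpose A ** A = mat 1 \<and> det A = 1"
  by (simp add: SO_def rotation_matrix_def orthogonal_matrix)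

text \<open>The Cayley transform of a skew-symmetric matrix, as a curve with the given velocity.\<close>

lemma cayley_curve:
  fixes A :: "real ^ 'n ^ 'n"
  assumes A: "transpose A = - A"
  obtains \<gamma> :: "real \<Rightarrow> real ^ 'n ^ 'n" where
    "\<And>t. \<gamma> t \<in> SO" "\<gamma> 0 = mat 1" "(\<gamma> has_vector_derivative A) (at 0)"
proof -
  define S where "S t = (t / 2) *\<^sub>R A" for t
  have trS: "transpose (S t) = - S t" for t by (simp add: S_def tr_scaleR A)
  have trm: "transpose (mat 1 - S t) = mat 1 + S t" for t by (simp add: tr_diff trS)
  have trp: "transpose (mat 1 + S t) = mat 1 - S t" for t by (simp add: tr_add trS)
  have ge: "norm ((mat 1 - S t) *v x) \<ge> norm x" for t x
  proof -
    have skew: "x \<bullet> (S t *v x) = 0"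
    proof -
      have "x \<bullet> (S t *v x) = (transpose (S t) *v x) \<bullet> x"
        by (metis dot_lmul_matrix inner_commute transpose_matrix_vector transpose_transpose)
      also have "\<dots> = - (x \<bullet> (S t *v x))"
        unfolding trS
        by (simp add: inner_vec_def matrix_vector_mult_def sum_negf mult.commute)
      finally show ?thesis by simp
    qed
    have "norm x ^ 2 \<le> norm (x - S t *v x) ^ 2"
      using skew by (simp add: power2_norm_eq_inner inner_diff_left inner_diff_right inner_commute)
    then show ?thesis
      by (simp add: matrix_vector_mult_diff_rdistrib power2_le_iff_abs_le)
  qed
  have inv: "invertible (mat 1 - S t)" for t
    unfolding invertible_left_inverse matrix_left_invertible_ker
    using ge by (metis norm_eq_zero norm_le_zero_iff)
  then obtain B where B1: "B t ** (mat 1 - S t) = mat 1" "(mat 1 - S t) ** B t = mat 1" for t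
    unfolding invertible_def by metis
  have comm: "(mat 1 - S t) ** (mat 1 + S t) = (mat 1 + S t) ** (mat 1 - S t)" for t
    by (simp add: mm_add_left mm_add_right mm_diff_left mm_diff_right)
  have trB: "transpose (B t) ** (mat 1 + S t) = mat 1" "(mat 1 + S t) ** transpose (B t) = mat 1" for t
    using B1[of t] by (metis matrix_transpose_mul transpose_mat trm)+
  define \<gamma> where "\<gamma> t = (mat 1 + S t) ** B t" for t
  have "transpose (\<gamma> t) ** \<gamma> t = mat 1" for t
  proof -
    have "transpose (\<gamma> t) ** \<gamma> t = transpose (B t) ** ((mat 1 - S t) ** (mat 1 + S t)) ** B t"
      by (simp add: \<gamma>_def matrix_transpose_mul trp matrix_mul_assoc)
    also have "\<dots> = (transpose (B t) ** (mat 1 + S t)) ** ((mat 1 - S t) ** B t)"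
      unfolding comm by (simp add: matrix_mul_assoc)
    finally show ?thesis by (simp add: B1 trB)
  qed
  moreover have "det (\<gamma> t) = 1" for t
  proof -
    have "det (mat 1 + S t) = det (mat 1 - S t)" by (metis trm det_transpose)
    then have "det (\<gamma> t) = det ((mat 1 - S t) ** B t)" by (simp add: \<gamma>_def det_mul)
    then show ?thesis by (simp add: B1)
  qed
  ultimately have SO: "\<gamma> t \<in> SO" for t by (simp add: SO_iff)
  have "\<gamma> t = mat 1 + t *\<^sub>R (A ** B t)" for t
  proof -
    have "t *\<^sub>R (A ** B t) = S t ** B t + S t ** B t"
      by (simp only: S_def mm_scaleR_left scaleR_add_left[symmetric]) simp
    moreover have "mat 1 = (mat 1 - S t) ** B t" by (simp add: B1)
    moreover have "(mat 1 - S t) ** B t + (S t ** B t + S t ** B t) = \<gamma> t"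
      by (simp add: \<gamma>_def mm_add_left mm_diff_left)
    ultimately show ?thesis by simp
  qed
  note \<gamma>_eq = this
  have B_bd: "norm (B t) \<le> CARD('n) * CARD('n)" for t
  proof -
    have "\<bar>B t $ i $ j\<bar> \<le> 1" for i j
    proof -
      have "norm (B t *v axis j 1) \<le> norm ((mat 1 - S t) *v (B t *v axis j 1))" by (rule ge)
      also have "\<dots> = 1" by (simp add: matrix_vector_mul_assoc B1)
      finally have "norm (column j (B t)) \<le> 1" by (simp add: matrix_vector_mult_basis)
      moreover have "\<bar>column j (B t) $ i\<bar> \<le> norm (column j (B t))" by (rule component_le_norm_cart)
      ultimately show ?thesis by (simp add: column_def)
    qed
    then have "norm (B t $ i) \<le> CARD('n)" for i
      by (intro order_trans[OF norm_le_l1_cart] order_trans[OF sum_bounded_above[of _ _ 1]]) auto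
    then show ?thesis
      using sum_bounded_above[of UNIV "\<lambda>i. norm (B t $ i)" "real CARD('n)"]
      by (auto simp: norm_vec_def[of "B t"] intro: order_trans[OF L2_set_le_sum])
  qed
  have B0: "(B \<longlongrightarrow> mat 1) (at 0)"
  proof -
    obtain K where "0 \<le> K" and K: "norm (a ** b) \<le> norm a * norm b * K" for a b :: "real ^ 'n ^ 'n"
      using bounded_bilinear.nonneg_bounded[OF bounded_bilinear_matrix_mult[where 'n='n]] by metis
    have "norm (B t - mat 1) \<le> \<bar>t\<bar> * (norm A * (CARD('n) * CARD('n)) * K)" for t
    proof -
      have "B t - mat 1 = S t ** B t"
        using B1(2)[of t] by (simp add: mm_diff_left algebra_simps)
      then have "norm (B t - mat 1) = \<bar>t\<bar> / 2 * norm (A ** B t)" by (simp add: S_def mm_scaleR_left)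
      also have "\<dots> \<le> \<bar>t\<bar> * norm (A ** B t)" by (intro mult_right_mono) auto
      also have "\<dots> \<le> \<bar>t\<bar> * (norm A * (CARD('n) * CARD('n)) * K)"
        by (intro mult_left_mono order_trans[OF K] mult_right_mono B_bd \<open>0 \<le> K\<close>) simp_all
      finally show ?thesis .
    qed
    moreover have "((\<lambda>t. \<bar>t\<bar> * (norm A * (CARD('n) * CARD('n)) * K)) \<longlongrightarrow> 0) (at (0::real))"
      by (intro tendsto_mult_left_zero tendsto_rabs_zero tendsto_ident_at)
    ultimately have "((\<lambda>t. B t - mat 1) \<longlongrightarrow> 0) (at 0)"
      by (rule Lim_null_comparison[OF always_eventually[OF allI]])
    then show ?thesis by (rule LIM_zero_cancel)
  qed
  have "((\<lambda>t. A ** B t) \<longlongrightarrow> A) (at 0)"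
    using mm_tendsto[OF tendsto_const B0, of A] by simp
  then have "((\<lambda>t. norm (A ** B t - A)) \<longlongrightarrow> 0) (at 0)"
    using tendsto_norm_zero LIM_zero by blast
  moreover have "norm (\<gamma> t - \<gamma> 0 - t *\<^sub>R A) / norm t = norm (A ** B t - A)" if "t \<noteq> 0" for t
  proof -
    have "\<gamma> t - \<gamma> 0 - t *\<^sub>R A = t *\<^sub>R (A ** B t - A)" by (simp add: \<gamma>_eq scaleR_diff_right)
    then show ?thesis using that by simp
  qed
  ultimately have "((\<lambda>t. norm (\<gamma> t - \<gamma> 0 - t *\<^sub>R A) / norm t) \<longlongrightarrow> 0) (at 0)"
    by (simp cong: Lim_cong_within)
  then have "(\<gamma> has_vector_derivative A) (at 0)"
    by (simp add: has_vector_derivative_def has_derivative_at bounded_linear_scaleR_left)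
  with SO show ?thesis by (intro that[of \<gamma>]) (auto simp: \<gamma>_eq)
qed

lemma tangent_space_SO:
  fixes p :: "real ^ 'n ^ 'n"
  assumes p: "p \<in> SO"
  shows "tangent_space SO p = {v. transpose p ** v + transpose v ** p = 0}"
proof (intro set_eqI iffI)
  fix v assume "v \<in> tangent_space SO p"
  then obtain \<gamma> :: "real \<Rightarrow> real ^ 'n ^ 'n" where
    \<gamma>: "\<forall>t. \<gamma> t \<in> SO" "\<gamma> 0 = p" "(\<gamma> has_vector_derivative v) (at 0)"
    by (auto simp: tangent_space_def)
  have "((\<lambda>t. transpose (\<gamma> t) ** \<gamma> t) has_vector_derivative
      transpose (\<gamma> 0) ** v + transpose v ** \<gamma> 0) (at 0)"
    by (intro mm_has_vector_derivative tr_has_vector_derivative \<gamma>)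
  moreover have "((\<lambda>t. transpose (\<gamma> t) ** \<gamma> t) has_vector_derivative 0) (at 0)"
    using \<gamma>(1) by (simp add: SO_iff)
  ultimately show "v \<in> {v. transpose p ** v + transpose v ** p = 0}"
    using \<gamma>(2) vector_derivative_unique_at by fastforce
next
  fix v assume v: "v \<in> {v. transpose p ** v + transpose v ** p = 0}"
  define A where "A = transpose p ** v"
  have "transpose A = - A"
    using v by (simp add: A_def matrix_transpose_mul eq_neg_iff_add_eq_0 add.commute)
  then obtain \<gamma> :: "real \<Rightarrow> real ^ 'n ^ 'n" where
    \<gamma>: "\<And>t. \<gamma> t \<in> SO" "\<gamma> 0 = mat 1" "(\<gamma> has_vector_derivative A) (at 0)"
    using cayley_curve by metis
  have "p ** transpose p = mat 1" using p by (simp add: SO_iff matrix_left_right_inverse)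
  then have "p ** A = v" by (simp add: A_def matrix_mul_assoc)
  then have "((\<lambda>t. p ** \<gamma> t) has_vector_derivative v) (at 0)"
    using mm_has_vector_derivative[OF has_vector_derivative_const \<gamma>(3), of p] by simp
  moreover have "p ** \<gamma> t \<in> SO" for t
    using p \<gamma>(1)[of t] by (simp add: SO_def rotation_matrix_def orthogonal_matrix_mul det_mul)
  ultimately show "v \<in> tangent_space SO p"
    unfolding tangent_space_def using \<gamma>(2) by (intro CollectI exI[of _ "\<lambda>t. p ** \<gamma> t"]) simp
qed

lemma subspace_tangent_space_SO: "p \<in> SO \<Longrightarrow> subspace (tangent_space SO (p :: real ^ 'n ^ 'n))"
  unfolding tangent_space_SO
  by (intro linear_subspace_kernel linearI)
     (simp_all add: tr_add tr_scaleR mm_add_left mm_add_right mm_scaleR_left mm_scaleR_right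
       scaleR_add_right add_ac)

text \<open>The Levi-Civita connection of the rotation group is metric and torsion-free.\<close>

lemma LC_SO_tangent: "p \<in> SO \<Longrightarrow> LC SO X p v \<in> tangent_space SO (p :: real ^ 'n ^ 'n)"
  unfolding pullback_LC_def by (simp add: orth_proj_in subspace_tangent_space_SO)

lemma LC_SO_metric:
  fixes X Y :: "real ^ 'n ^ 'n \<Rightarrow> real ^ 'n ^ 'n"
  assumes p: "p \<in> SO" and v: "v \<in> tangent_space SO p"
    and X: "\<And>q. q \<in> SO \<Longrightarrow> X q \<in> tangent_space SO q" "X differentiable at p within SO"
    and Y: "\<And>q. q \<in> SO \<Longrightarrow> Y q \<in> tangent_space SO q" "Y differentiable at p within SO"
  shows "frechet_derivative (\<lambda>q. X q \<bullet> Y q) (at p within SO) v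
    = LC SO X p v \<bullet> Y p + X p \<bullet> LC SO Y p v"
proof -
  note XY = X(2)[unfolded frechet_derivative_works] Y(2)[unfolded frechet_derivative_works]
  have "frechet_derivative (\<lambda>q. X q \<bullet> Y q) (at p within SO) v
    = X p \<bullet> frechet_derivative Y (at p within SO) v + frechet_derivative X (at p within SO) v \<bullet> Y p"
    by (rule frechet_derivative_tangent[OF has_derivative_inner[OF XY] v])
  then show ?thesis
    using X(1)[OF p] Y(1)[OF p] subspace_tangent_space_SO[OF p]
    by (simp add: pullback_LC_def orth_proj_inner inner_commute[of "X p"])
qed

text \<open>The right-hand side is the Lie bracket of the two fields in the coordinates of the ambient
  space.\<close>

lemma LC_SO_torsion_free:
  fixes X Y :: "real ^ 'n ^ 'n \<Rightarrow> real ^ 'n ^ 'n"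
  assumes p: "p \<in> SO"
    and X: "\<And>q. q \<in> SO \<Longrightarrow> X q \<in> tangent_space SO q" "X differentiable at p within SO"
    and Y: "\<And>q. q \<in> SO \<Longrightarrow> Y q \<in> tangent_space SO q" "Y differentiable at p within SO"
  shows "LC SO Y p (X p) - LC SO X p (Y p)
    = frechet_derivative Y (at p within SO) (X p) - frechet_derivative X (at p within SO) (Y p)"
proof -
  define dX where "dX = frechet_derivative X (at p within SO)"
  define dY where "dY = frechet_derivative Y (at p within SO)"
  note XY = X(2)[unfolded frechet_derivative_works, folded dX_def]
    Y(2)[unfolded frechet_derivative_works, folded dY_def]
  have S: "subspace (tangent_space SO p)" by (rule subspace_tangent_space_SO[OF p])
  have tangency: "(transpose p ** dZ v + transpose v ** Z p) + (transpose (Z p) ** v + transpose (dZ v) ** p) = 0"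
    if Z: "\<And>q. q \<in> SO \<Longrightarrow> Z q \<in> tangent_space SO q" "(Z has_derivative dZ) (at p within SO)"
      and v: "v \<in> tangent_space SO p" for Z dZ v
  proof -
    let ?c = "\<lambda>q. transpose q ** Z q + transpose (Z q) ** q"
    have "(?c has_derivative (\<lambda>v. (transpose p ** dZ v + transpose v ** Z p)
        + (transpose (Z p) ** v + transpose (dZ v) ** p))) (at p within SO)"
      by (intro has_derivative_add mm_FDERIV tr_has_derivative Z has_derivative_ident)
    from frechet_derivative_tangent[OF this v]
    have "frechet_derivative ?c (at p within SO) v = (transpose p ** dZ v + transpose v ** Z p)
        + (transpose (Z p) ** v + transpose (dZ v) ** p)" .
    moreover have "(?c has_derivative (\<lambda>_. 0)) (at p within SO)"
      by (rule has_derivative_transform[OF p _ has_derivative_const[of 0]])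
         (use Z(1) tangent_space_SO in blast)
    from frechet_derivative_tangent[OF this v]
    have "frechet_derivative ?c (at p within SO) v = 0" .
    ultimately show ?thesis by simp
  qed
  have skew_cancel: "(a - b) + (c - d) = 0"
    if "(b + e) + (f + d) = 0" "(a + f) + (e + c) = 0" for a b c d e f :: "real ^ 'n ^ 'n"
  proof -
    have "(a - b) + (c - d) = ((a + f) + (e + c)) - ((b + e) + (f + d))" by simp
    then show ?thesis unfolding that by simp
  qed
  have "dY (X p) - dX (Y p) \<in> tangent_space SO p"
    unfolding tangent_space_SO[OF p] mem_Collect_eq mm_diff_right mm_diff_left tr_diff
    by (rule skew_cancel[OF tangency[OF X(1) XY(1) Y(1)[OF p]] tangency[OF Y(1) XY(2) X(1)[OF p]]])
  then have "orth_proj (tangent_space SO p) (dY (X p))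
      = orth_proj (tangent_space SO p) (dX (Y p)) + (dY (X p) - dX (Y p))"
    by (intro orth_proj_eqI[OF S] subspace_add[OF S] orth_proj_in[OF S])
       (simp_all add: inner_add_left inner_diff_left orth_proj_inner[OF S])
  then show ?thesis by (simp add: pullback_LC_def dX_def dY_def)
qed

text \<open>The pullback connection along \<open>f\<close> satisfies the Leibniz rule and restricts to the Levi-Civita
  connection on sections of the form \<open>X \<circ> f\<close>.\<close>

lemma pullback_LC_SO_comp:
  fixes f :: "'b::euclidean_space \<Rightarrow> real ^ 'n ^ 'n"
  assumes x: "x \<in> N" and f: "f \<in> N \<rightarrow> SO" "(f has_derivative f') (at x within N)"
    and w: "w \<in> tangent_space N x" and X: "X differentiable at (f x) within SO"
  shows "pullback_LC SO N f (\<lambda>y. X (f y)) x w = LC SO X (f x) (f' w)"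
proof -
  have "(X has_derivative frechet_derivative X (at (f x) within SO)) (at (f x) within f ` N)"
    using X f(1) has_derivative_subset unfolding frechet_derivative_works by blast
  from frechet_derivative_tangent[OF diff_chain_within[OF f(2) this] w] show ?thesis
    by (simp add: pullback_LC_def o_def)
qed

lemma pullback_LC_SO_Leibniz:
  fixes f :: "'b::euclidean_space \<Rightarrow> real ^ 'n ^ 'n" and a :: "'b \<Rightarrow> real"
  assumes x: "x \<in> N" and f: "f \<in> N \<rightarrow> SO" and w: "w \<in> tangent_space N x"
    and a: "(a has_derivative a') (at x within N)"
    and s: "s differentiable at x within N" "s x \<in> tangent_space SO (f x)"
  shows "pullback_LC SO N f (\<lambda>y. a y *\<^sub>R s y) x w = a' w *\<^sub>R s x + a x *\<^sub>R pullback_LC SO N f s x w"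
proof -
  have S: "subspace (tangent_space SO (f x))" using subspace_tangent_space_SO x f by blast
  have "frechet_derivative (\<lambda>y. a y *\<^sub>R s y) (at x within N) w
      = a x *\<^sub>R frechet_derivative s (at x within N) w + a' w *\<^sub>R s x"
    by (rule frechet_derivative_tangent[OF has_derivative_scaleR[OF a
          s(1)[unfolded frechet_derivative_works]] w])
  then show ?thesis
    unfolding pullback_LC_def
    by (intro orth_proj_eqI[OF S])
       (auto intro!: subspace_add[OF S] subspace_scale[OF S] orth_proj_in[OF S] s(2)
         simp: inner_add_left orth_proj_inner[OF S])
qed

end

theory Submission
  imports Defs
begin

text \<open>For a skew-symmetric matrix \<open>A\<close> the geodesics are \<open>t \<mapsto> p mexp (t A)\<close>, so the Hessian of the
  exponential map is the tangential part of the second derivative of the matrix exponential. Along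
  \<open>t \<mapsto> mexp (t A)\<close> the first and second derivatives solve linear differential equations. After left
  translation to the identity, the terms of order two in \<open>t\<close> of the skew part of the second
  derivative cancel, and what remains is estimated by commutators. Each commutator of
  skew-symmetric matrices costs a factor \<open>sqrt 2\<close> in the Frobenius norm, and \<open>r / 3\<close> is
  \<open>(sqrt 2)\<^sup>2 r / 2\<close> times the integral of \<open>t\<^sup>2\<close> over \<open>[0, 1]\<close>.\<close>

section \<open>Exponential series\<close>

text \<open>The factorials beat any geometric growth of the terms and of their derivatives, so both
  series converge uniformly on balls and may be differentiated term by term. It serves
  \<open>mexp\<close>, \<open>dmexp\<close> and the power series of curves alike.\<close>

lemma exp_series_has_derivative:
  fixes f :: "nat \<Rightarrow> 'a::real_normed_vector \<Rightarrow> 'b::banach"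
  assumes f': "\<And>k x. (f k has_derivative f' k x) (at x)"
    and bound: "\<And>R. \<exists>C M. \<forall>k x. norm x < R \<longrightarrow>
      norm (f k x) \<le> C * M ^ k \<and> (\<forall>h. norm (f' k x h) \<le> C * M ^ k * norm h)"
  shows "((\<lambda>x. \<Sum>k. f k x /\<^sub>R fact k) has_derivative (\<lambda>h. \<Sum>k. f' k x h /\<^sub>R fact k)) (at x)"
    and "summable (\<lambda>k. f k x /\<^sub>R fact k)"
    and "summable (\<lambda>k. f' k x h /\<^sub>R fact k)"
proof -
  \<comment> \<open>The margin 1 puts \<open>x\<close> in the interior of the ball of radius
    \<open>R\<close>, where the derivative within the ball is the full derivative.\<close>
  define R where "R = norm x + 1"
  obtain C0 M0 where CM0: "norm (f k y) \<le> C0 * M0 ^ k" "norm (f' k y h) \<le> C0 * M0 ^ k * norm h"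
    if "norm y < R" for k y h using bound[of R] by metis
  define C M where "C = \<bar>C0\<bar>" and "M = \<bar>M0\<bar>"
  have "C0 * M0 ^ k \<le> C * M ^ k" for k
    unfolding C_def M_def by (metis abs_ge_self abs_mult power_abs)
  then have CM: "norm (f k y) \<le> C * M ^ k" "norm (f' k y h) \<le> C * M ^ k * norm h"
    if "norm y < R" for k y h
    using CM0[OF that, of k] by (meson mult_right_mono norm_ge_zero order_trans)+
  define a where "a k = C * (M ^ k /\<^sub>R fact k)" for k
  have a: "summable a" unfolding a_def by (intro summable_mult summable_exp_generic)
  have fa: "norm (f k y /\<^sub>R fact k) \<le> a k" "norm (f' k y h /\<^sub>R fact k) \<le> a k * norm h"
    if "norm y < R" for k y h
    using CM[OF that, of k] by (simp_all add: a_def field_simps)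
  have sf: "summable (\<lambda>k. f k y /\<^sub>R fact k)" if "norm y < R" for y
    using fa[OF that] by (intro summable_comparison_test'[OF a]) auto
  have sf': "summable (\<lambda>k. f' k y h /\<^sub>R fact k)" if "norm y < R" for y h
    using fa[OF that] by (intro summable_comparison_test'[OF summable_mult2[OF a]]) auto
  have x: "norm x < R" by (simp add: R_def)
  show "summable (\<lambda>k. f k x /\<^sub>R fact k)" "summable (\<lambda>k. f' k x h /\<^sub>R fact k)"
    using sf[OF x] sf'[OF x] by auto
  \<comment> \<open>The tail is dominated by that of the numerical majorant \<open>a\<close>, which
    depends neither on \<open>y\<close> nor on \<open>h\<close>; this is the required
    uniformity.\<close>
  have tail: "\<forall>\<^sub>F n in sequentially. \<forall>y\<in>ball 0 R. \<forall>h.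
      norm ((\<Sum>k<n. f' k y h /\<^sub>R fact k) - (\<Sum>k. f' k y h /\<^sub>R fact k)) \<le> e * norm h"
    if e: "e > 0" for e
  proof -
    have "(\<lambda>n. \<Sum>k<n. a k) \<longlonglongrightarrow> suminf a" using a by (simp add: summable_LIMSEQ)
    from tendstoD[OF this e]
    have "\<forall>\<^sub>F n in sequentially. \<bar>sum a {..<n} - suminf a\<bar> < e" by (simp add: dist_real_def)
    then show ?thesis
    proof eventually_elim
      case (elim n)
      show ?case
      proof (intro ballI allI)
        fix y :: 'a and h :: 'a assume "y \<in> ball 0 R"
        then have y: "norm y < R" by simp
        have "norm ((\<Sum>k<n. f' k y h /\<^sub>R fact k) - (\<Sum>k. f' k y h /\<^sub>R fact k))
            = norm (\<Sum>k. f' (k + n) y h /\<^sub>R fact (k + n))"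
          by (subst suminf_split_initial_segment[OF sf'[OF y], where k = n])
             (simp add: norm_minus_commute)
        also have "\<dots> \<le> (\<Sum>k. a (k + n) * norm h)"
          by (intro norm_suminf_le summable_mult2 summable_ignore_initial_segment a fa(2)[OF y])
        also have "\<dots> = (\<Sum>k. a (k + n)) * norm h"
          by (intro suminf_mult2[symmetric] summable_ignore_initial_segment a)
        also have "\<dots> \<le> e * norm h"
          using elim by (intro mult_right_mono) (auto simp: suminf_split_initial_segment[OF a, of n])
        finally show "norm ((\<Sum>k<n. f' k y h /\<^sub>R fact k) - (\<Sum>k. f' k y h /\<^sub>R fact k)) \<le> e * norm h" .
      qed
    qed
  qed
  have "\<exists>g. \<forall>y\<in>ball 0 R. (\<lambda>k. f k y /\<^sub>R fact k) sums g y
      \<and> (g has_derivative (\<lambda>h. \<Sum>k. f' k y h /\<^sub>R fact k)) (at y within ball 0 R)"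
  proof (rule has_derivative_series[OF convex_ball _ tail])
    show "((\<lambda>x. f k x /\<^sub>R fact k) has_derivative (\<lambda>h. f' k y h /\<^sub>R fact k)) (at y within ball 0 R)" for k y
      by (rule has_derivative_scaleR_right[OF has_derivative_at_withinI[OF f']])
    show "x \<in> ball 0 R" using x by simp
    show "(\<lambda>k. f k x /\<^sub>R fact k) sums (\<Sum>k. f k x /\<^sub>R fact k)" using sf[OF x] by (rule summable_sums)
  qed
  then obtain g where "\<forall>y\<in>ball 0 R. (\<lambda>k. f k y /\<^sub>R fact k) sums g y
      \<and> (g has_derivative (\<lambda>h. \<Sum>k. f' k y h /\<^sub>R fact k)) (at y within ball 0 R)"
    by blast
  then have g: "\<And>y. norm y < R \<Longrightarrow> (\<lambda>k. f k y /\<^sub>R fact k) sums g y"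
    "(g has_derivative (\<lambda>h. \<Sum>k. f' k x h /\<^sub>R fact k)) (at x within ball 0 R)"
    using x by simp_all
  have wx: "at x within ball 0 R = at x" using x by (intro at_within_open) auto
  have "(g has_derivative (\<lambda>h. \<Sum>k. f' k x h /\<^sub>R fact k)) (at x)"
    using g(2) unfolding wx .
  then show "((\<lambda>x. \<Sum>k. f k x /\<^sub>R fact k) has_derivative (\<lambda>h. \<Sum>k. f' k x h /\<^sub>R fact k)) (at x)"
    by (rule has_derivative_transform_within_open[of g _ _ _ "ball 0 R"])
       (use g(1)[THEN sums_unique] x in simp_all)
qed

text \<open>The factor \<open>k\<close> from differentiating \<open>t ^ k\<close> cancels against
  \<open>fact k\<close>, so differentiation merely shifts the coefficient sequence by one.\<close>

corollary exp_series_has_vector_derivative: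
  fixes c :: "nat \<Rightarrow> 'b::banach"
  assumes c: "\<And>k. norm (c k) \<le> C * M ^ k"
  shows "((\<lambda>t. \<Sum>k. (t ^ k *\<^sub>R c k) /\<^sub>R fact k) has_vector_derivative
    (\<Sum>k. (t ^ k *\<^sub>R c (Suc k)) /\<^sub>R fact k)) (at t)"
proof -
  let ?f = "\<lambda>k t. t ^ k *\<^sub>R c k" and ?f' = "\<lambda>k t h. (h * (real k * t ^ (k - 1))) *\<^sub>R c k"
  have C0: "0 \<le> C" using c[of 0] norm_ge_zero[of "c 0"] by (simp del: norm_ge_zero)
  have 1: "(?f k has_derivative ?f' k t) (at t)" for k t
    by (auto intro!: derivative_eq_intros)
  have 2: "\<exists>C M. \<forall>k x. norm x < R \<longrightarrow>
      norm (?f k x) \<le> C * M ^ k \<and> (\<forall>h. norm (?f' k x h) \<le> C * M ^ k * norm h)" for R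
  proof (intro exI allI impI conjI)
    fix k and x :: real assume x: "norm x < R"
    \<comment> \<open>With \<open>Q\<close> at least 1, \<open>Q ^ k\<close> also dominates the
      power with exponent \<open>k - 1\<close>. The factor \<open>k\<close> is absorbed by
      \<open>2 ^ k\<close>, which gives the ratio \<open>2 * Q * \<bar>M\<bar>\<close>.\<close>
    define Q where "Q = max 1 R"
    have Q: "1 \<le> Q" "\<bar>x\<bar> \<le> Q" using x by (auto simp: Q_def)
    have xk: "\<bar>x\<bar> ^ k \<le> Q ^ k" using Q by (intro power_mono) auto
    have xk1: "\<bar>x\<bar> ^ (k - 1) \<le> Q ^ k"
      using Q power_mono[of "\<bar>x\<bar>" Q "k - 1"] power_increasing[of "k - 1" k Q] by linarith
    have k2: "real k \<le> 2 ^ k" by (metis less_exp less_imp_le of_nat_le_numeral_power_cancel_iff)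
    have M: "Q ^ k * \<bar>M\<bar> ^ k \<ge> 0" using Q by simp
    have ck: "norm (c k) \<le> C * \<bar>M\<bar> ^ k"
      using c[of k] C0 by (metis abs_ge_self mult_left_mono order_trans power_abs)
    have pos: "0 \<le> C * (Q ^ k * \<bar>M\<bar> ^ k)" using M C0 by simp
    have "norm (?f k x) \<le> Q ^ k * (C * \<bar>M\<bar> ^ k)"
      using Q by (simp add: power_abs) (intro mult_mono xk ck, auto)
    also have "\<dots> \<le> 2 ^ k * (Q ^ k * (C * \<bar>M\<bar> ^ k))"
      using mult_right_mono[of 1 "2 ^ k", OF _ pos] by (simp add: mult_ac)
    finally show "norm (?f k x) \<le> C * (2 * Q * \<bar>M\<bar>) ^ k"
      by (simp add: power_mult_distrib mult_ac)
    fix h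
    have "norm (?f' k x h) = \<bar>h\<bar> * (real k * \<bar>x\<bar> ^ (k - 1) * norm (c k))"
      by (simp add: abs_mult power_abs)
    also have "\<dots> \<le> \<bar>h\<bar> * (2 ^ k * Q ^ k * (C * \<bar>M\<bar> ^ k))"
      using Q by (intro mult_left_mono mult_mono k2 xk1 ck) auto
    finally show "norm (?f' k x h) \<le> C * (2 * Q * \<bar>M\<bar>) ^ k * norm h"
      by (simp add: power_mult_distrib mult_ac)
  qed
  note D = exp_series_has_derivative[of ?f ?f', OF 1 2]
  have eq: "?f' (Suc k) t h /\<^sub>R fact (Suc k) = h *\<^sub>R ((t ^ k *\<^sub>R c (Suc k)) /\<^sub>R fact k)" for k h
  proof -
    have "inverse (fact (Suc k)) * real (Suc k) = inverse (fact k)"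
      by (simp add: field_simps del: of_nat_Suc)
    moreover have "inverse (fact (Suc k)) * (h * (real (Suc k) * t ^ k))
        = h * ((inverse (fact (Suc k)) * real (Suc k)) * t ^ k)" by (simp only: mult_ac)
    ultimately show ?thesis by (simp only: scaleR_scaleR diff_Suc_1)
  qed
  \<comment> \<open>The term at \<open>k = 0\<close> carries the factor 0, so the sum may start at
    \<open>Suc 0\<close> and be reindexed.\<close>
  have "(\<Sum>k. ?f' k t h /\<^sub>R fact k) = h *\<^sub>R (\<Sum>k. (t ^ k *\<^sub>R c (Suc k)) /\<^sub>R fact k)" for h
  proof -
    have "(\<Sum>k. ?f' k t h /\<^sub>R fact k) = (\<Sum>k. ?f' (Suc k) t h /\<^sub>R fact (Suc k))"
      by (subst suminf_split_head[OF D(3)]) simp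
    moreover have "summable (\<lambda>k. (t ^ k *\<^sub>R c (Suc k)) /\<^sub>R fact k)"
      using summable_ignore_initial_segment[OF D(3)[of 1 t], of 1]
      unfolding Suc_eq_plus1[symmetric] eq by simp
    ultimately show ?thesis unfolding eq by (simp add: suminf_scaleR_right)
  qed
  with D(1)[of t] show ?thesis by (simp add: has_vector_derivative_def)
qed

section \<open>The Frobenius norm\<close>

lemma norm_transpose: "norm (transpose A) = norm (A :: real ^ 'n ^ 'm)"
  by (simp add: norm_eq_sqrt_inner inner_vec_def transpose_def) (subst sum.swap, rule refl)

lemma norm_matrix_columns: "(norm (A :: real ^ 'n ^ 'm))\<^sup>2 = (\<Sum>j\<in>UNIV. (norm (column j A))\<^sup>2)"
  by (simp add: power2_norm_eq_inner inner_vec_def column_def) (rule sum.swap)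

lemma column_mult: "column j (A ** B) = A *v column j B"
  by (simp add: vec_eq_iff column_def matrix_matrix_mult_def matrix_vector_mult_def)

text \<open>The squared Frobenius norm is the sum of the squared column norms, and \<open>A\<close>
  acts on \<open>B\<close> column by column; hence an operator bound for \<open>A\<close> passes to
  the Frobenius norm.\<close>

lemma norm_mult_le_of_norm_vec_le:
  fixes A :: "real ^ 'n ^ 'm" and B :: "real ^ 'k ^ 'n"
  assumes "0 \<le> c" "\<And>x. norm (A *v x) \<le> c * norm x"
  shows "norm (A ** B) \<le> c * norm B"
proof (rule power2_le_imp_le)
  have "(norm (A ** B))\<^sup>2 = (\<Sum>j\<in>UNIV. (norm (A *v column j B))\<^sup>2)"
    by (simp add: norm_matrix_columns column_mult)
  also have "\<dots> \<le> (\<Sum>j\<in>UNIV. (c * norm (column j B))\<^sup>2)"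
    using assms by (intro sum_mono power_mono) auto
  also have "\<dots> = (c * norm B)\<^sup>2"
    by (simp add: norm_matrix_columns[of B] power_mult_distrib sum_distrib_left)
  finally show "(norm (A ** B))\<^sup>2 \<le> (c * norm B)\<^sup>2" .
qed (use assms in auto)

lemma norm_matrix_mult_le: "norm (A ** B) \<le> norm A * norm (B :: real ^ 'k ^ 'n)"
  for A :: "real ^ 'n ^ 'm"
proof (rule norm_mult_le_of_norm_vec_le)
  fix x
  have "(norm (A *v x))\<^sup>2 \<le> (\<Sum>i\<in>UNIV. (norm (row i A) * norm x)\<^sup>2)"
    unfolding power2_norm_eq_inner[of "A *v x"] inner_vec_def[of "A *v x"]
  proof (rule sum_mono)
    fix i
    have "(A *v x) $ i = row i A \<bullet> x" by (simp add: matrix_vector_mult_def row_def inner_vec_def)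
    then have "\<bar>(A *v x) $ i\<bar> \<le> norm (row i A) * norm x" by (simp add: Cauchy_Schwarz_ineq2)
    from power_mono[OF this, of 2]
    show "(A *v x) $ i \<bullet> (A *v x) $ i \<le> (norm (row i A) * norm x)\<^sup>2" by (simp add: power2_eq_square)
  qed
  also have "\<dots> = (norm (transpose A) * norm x)\<^sup>2"
    by (simp add: norm_matrix_columns[of "transpose A"] column_transpose power_mult_distrib sum_distrib_right)
  finally show "norm (A *v x) \<le> norm A * norm x"
    by (simp add: norm_transpose power2_le_iff_abs_le)
qed simp

text \<open>Left multiplication preserves the length of every column; right multiplication reduces
  to it by transposing.\<close>

lemma norm_mult_orthogonal:
  fixes Q A :: "real ^ 'n ^ 'n"
  assumes Q: "transpose Q ** Q = mat 1"
  shows "norm (Q ** A) = norm A" "norm (A ** Q) = norm A"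
proof -
  have *: "norm (P ** B) = norm B" if P: "transpose P ** P = mat 1" for P B :: "real ^ 'n ^ 'n"
  proof -
    have "norm (P *v x) = norm x" for x
    proof -
      have "(P *v x) \<bullet> (P *v x) = x \<bullet> ((transpose P ** P) *v x)"
        by (metis dot_lmul_matrix inner_commute matrix_vector_mul_assoc transpose_matrix_vector transpose_transpose)
      then show ?thesis by (simp add: P norm_eq_sqrt_inner)
    qed
    then have "(norm (P ** B))\<^sup>2 = (norm B)\<^sup>2" by (simp add: norm_matrix_columns column_mult)
    then show ?thesis by simp
  qed
  show "norm (Q ** A) = norm A" by (rule *[OF Q])
  have "norm (A ** Q) = norm (transpose Q ** transpose A)"
    by (metis matrix_transpose_mul norm_transpose)
  also have "\<dots> = norm A"
    using *[of "transpose Q" "transpose A"] Q by (simp add: matrix_left_right_inverse norm_transpose)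
  finally show "norm (A ** Q) = norm A" .
qed

text \<open>The two equal singular values of a skew-symmetric matrix give the factor \<open>1 / sqrt 2\<close>: pair \<open>A\<close>
  with the skew-symmetric matrix \<open>y x\<^sup>T - x y\<^sup>T\<close>, where \<open>y = A x\<close>.\<close>

lemma norm_skew_mult_vec:
  fixes A :: "real ^ 'n ^ 'n"
  assumes A: "transpose A = - A"
  shows "norm (A *v x) \<le> norm A / sqrt 2 * norm x"
proof -
  define y where "y = A *v x"
  define M :: "real ^ 'n ^ 'n" where "M = (\<chi> i j. y $ i * x $ j - x $ i * y $ j)"
  have xA: "x \<bullet> (A *v y) = - (y \<bullet> y)"
  proof -
    have "x \<bullet> (A *v y) = (transpose A *v x) \<bullet> y"
      by (metis dot_lmul_matrix transpose_matrix_vector)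
    also have "\<dots> = - (y \<bullet> y)"
      unfolding A y_def by (simp add: inner_vec_def matrix_vector_mult_def sum_negf)
    finally show ?thesis .
  qed
  have outer: "A \<bullet> (\<chi> i j. u $ i * w $ j) = u \<bullet> (A *v w)" for u w :: "real ^ 'n"
    by (simp add: inner_vec_def matrix_vector_mult_def sum_distrib_left mult_ac)
  have "M = (\<chi> i j. y $ i * x $ j) - (\<chi> i j. x $ i * y $ j)" by (simp add: M_def vec_eq_iff)
  then have "A \<bullet> M = y \<bullet> (A *v x) - x \<bullet> (A *v y)" by (simp add: inner_diff_right outer)
  then have AM: "A \<bullet> M = 2 * (norm y)\<^sup>2" by (simp add: xA y_def[symmetric] power2_norm_eq_inner)
  \<comment> \<open>This is Lagrange's identity; dropping the last square gives the upper bound for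
    \<open>norm M\<close>.\<close>
  have "(norm M)\<^sup>2 = 2 * (norm x)\<^sup>2 * (norm y)\<^sup>2 - 2 * (x \<bullet> y)\<^sup>2"
  proof -
    have "(norm M)\<^sup>2 = (\<Sum>i\<in>UNIV. \<Sum>j\<in>UNIV. (y $ i * y $ i) * (x $ j * x $ j)
        + (x $ i * x $ i) * (y $ j * y $ j) - 2 * ((x $ i * y $ i) * (x $ j * y $ j)))"
      by (simp add: power2_norm_eq_inner inner_vec_def M_def algebra_simps)
    also have "\<dots> = (y \<bullet> y) * (x \<bullet> x) + (x \<bullet> x) * (y \<bullet> y) - 2 * ((x \<bullet> y) * (x \<bullet> y))"
      unfolding inner_vec_def inner_real_def sum_product
      by (simp add: sum.distrib sum_subtractf sum_distrib_left)
    finally show ?thesis by (simp add: power2_norm_eq_inner power2_eq_square[of "x \<bullet> y"])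
  qed
  then have "(norm M)\<^sup>2 \<le> (sqrt 2 * norm x * norm y)\<^sup>2" by (simp add: power_mult_distrib)
  then have M: "norm M \<le> sqrt 2 * norm x * norm y" by (rule power2_le_imp_le) simp
  \<comment> \<open>Cauchy-Schwarz for \<open>A \<bullet> M\<close>; afterwards one factor
    \<open>norm y\<close> is cancelled, the case \<open>y = 0\<close> being trivial.\<close>
  have "2 * (norm y)\<^sup>2 \<le> norm A * (sqrt 2 * norm x * norm y)"
    using AM norm_cauchy_schwarz[of A M] mult_left_mono[OF M, of "norm A"] by simp
  then have "2 * norm y \<le> norm A * (sqrt 2 * norm x)" if "y \<noteq> 0"
    using that by (simp add: power2_eq_square mult.assoc[symmetric])
  then have "2 * norm y \<le> norm A * (sqrt 2 * norm x)" by (cases "y = 0") auto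
  also have "norm A * (sqrt 2 * norm x) = norm A * (2 / sqrt 2 * norm x)" by (simp add: real_div_sqrt)
  finally have "2 * norm y \<le> 2 * (norm A / sqrt 2 * norm x)" by (simp add: mult_ac)
  then show ?thesis by (simp add: y_def)
qed

text \<open>Both products are at most \<open>norm A * norm B / sqrt 2\<close>, the second after
  transposing so that \<open>A\<close> stands on the left, and \<open>2 / sqrt 2 = sqrt 2\<close>.
  Only one factor is skew-symmetric.\<close>

lemma norm_skew_commutator:
  fixes A B :: "real ^ 'n ^ 'n"
  assumes A: "transpose A = - A"
  shows "norm (A ** B - B ** A) \<le> sqrt 2 * norm A * norm B"
proof -
  have *: "norm (A ** C) \<le> norm A / sqrt 2 * norm C" for C
    by (intro norm_mult_le_of_norm_vec_le norm_skew_mult_vec A) simp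
  have "norm (B ** A) = norm (transpose (B ** A))" by (simp add: norm_transpose)
  also have "transpose (B ** A) = - (A ** transpose B)"
    using mm_diff_left[of 0 A "transpose B"] by (simp add: matrix_transpose_mul A mm_zero_left)
  finally have "norm (B ** A) \<le> norm A / sqrt 2 * norm B" using *[of "transpose B"] by (simp add: norm_transpose)
  then have "norm (A ** B - B ** A) \<le> 2 * (norm A / sqrt 2 * norm B)"
    using *[of B] norm_triangle_ineq4[of "A ** B" "B ** A"] by linarith
  also have "\<dots> = 2 / sqrt 2 * norm A * norm B" by simp
  also have "\<dots> = sqrt 2 * norm A * norm B" by (simp only: real_div_sqrt)
  finally show ?thesis .
qed

section \<open>The matrix exponential\<close>

primrec mpow :: "real ^ 'n ^ 'n \<Rightarrow> nat \<Rightarrow> real ^ 'n ^ 'n" where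
  "mpow A 0 = mat 1"
| "mpow A (Suc k) = A ** mpow A k"

text \<open>The first and second directional derivatives of the matrix power. As the matrices need
  not commute, they are given by recursions that arise from applying the Leibniz rule to the
  recursion of \<open>mpow\<close>, and then once more with \<open>W\<close> held fixed.\<close>

primrec dmpow :: "real ^ 'n ^ 'n \<Rightarrow> real ^ 'n ^ 'n \<Rightarrow> nat \<Rightarrow> real ^ 'n ^ 'n" where
  "dmpow A W 0 = 0"
| "dmpow A W (Suc k) = A ** dmpow A W k + W ** mpow A k"

primrec d2mpow :: "real ^ 'n ^ 'n \<Rightarrow> real ^ 'n ^ 'n \<Rightarrow> real ^ 'n ^ 'n \<Rightarrow> nat \<Rightarrow> real ^ 'n ^ 'n" where
  "d2mpow A H W 0 = 0"
| "d2mpow A H W (Suc k) = A ** d2mpow A H W k + H ** dmpow A W k + W ** dmpow A H k"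

definition mexp :: "real ^ 'n ^ 'n \<Rightarrow> real ^ 'n ^ 'n"
  where "mexp A = (\<Sum>k. mpow A k /\<^sub>R fact k)"

definition dmexp :: "real ^ 'n ^ 'n \<Rightarrow> real ^ 'n ^ 'n \<Rightarrow> real ^ 'n ^ 'n"
  where "dmexp A W = (\<Sum>k. dmpow A W k /\<^sub>R fact k)"

definition d2mexp :: "real ^ 'n ^ 'n \<Rightarrow> real ^ 'n ^ 'n \<Rightarrow> real ^ 'n ^ 'n \<Rightarrow> real ^ 'n ^ 'n"
  where "d2mexp A H W = (\<Sum>k. d2mpow A H W k /\<^sub>R fact k)"

section \<open>Differentiability of the matrix exponential and of its derivative\<close>

lemma mpow_has_derivative: "((\<lambda>A. mpow A k) has_derivative (\<lambda>H. dmpow A H k)) (at A)"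
proof (induction k)
  case (Suc k)
  show ?case using mm_FDERIV[OF has_derivative_ident Suc] by simp
qed simp

lemma dmpow_has_derivative: "((\<lambda>A. dmpow A W k) has_derivative (\<lambda>H. d2mpow A H W k)) (at A)"
proof (induction k)
  case (Suc k)
  show ?case
    using has_derivative_add[OF mm_FDERIV[OF has_derivative_ident Suc]
        mm_FDERIV[OF has_derivative_const[of W] mpow_has_derivative[of k A]]]
    by (simp add: mm_zero_left)
qed simp

lemma mpow_bound:
  assumes "norm (A :: real ^ 'n ^ 'n) \<le> R"
  shows "norm (mpow A k) \<le> norm (mat 1 :: real ^ 'n ^ 'n) * R ^ k"
proof (induction k)
  case (Suc k)
  have "norm (mpow A (Suc k)) \<le> norm A * norm (mpow A k)" by (simp add: norm_matrix_mult_le)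
  also have "\<dots> \<le> R * (norm (mat 1 :: real ^ 'n ^ 'n) * R ^ k)"
    using assms order_trans[OF norm_ge_zero assms] by (intro mult_mono Suc) auto
  finally show ?case by (simp add: mult_ac)
qed simp

lemma dmpow_bound:
  assumes A: "norm (A :: real ^ 'n ^ 'n) \<le> R" and R: "1 \<le> R"
  shows "norm (dmpow A W k) \<le> norm (mat 1 :: real ^ 'n ^ 'n) * (2 * R) ^ k * norm W"
proof (induction k)
  case (Suc k)
  define c where "c = norm (mat 1 :: real ^ 'n ^ 'n)"
  have c: "c \<ge> 0" by (simp add: c_def)
  have "norm (dmpow A W (Suc k)) \<le> norm A * norm (dmpow A W k) + norm W * norm (mpow A k)"
    by (auto intro!: norm_triangle_le add_mono norm_matrix_mult_le)
  also have "\<dots> \<le> R * (c * (2 * R) ^ k * norm W) + norm W * (c * R ^ k)"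
    unfolding c_def using R by (intro add_mono mult_mono Suc A mpow_bound) auto
  also have "\<dots> \<le> R * (c * (2 * R) ^ k * norm W) + norm W * (c * (R * (2 * R) ^ k))"
  proof -
    have "R ^ k \<le> (2 * R) ^ k" using R by (intro power_mono) auto
    also have "\<dots> \<le> R * (2 * R) ^ k" using mult_right_mono[OF R, of "(2 * R) ^ k"] R by simp
    finally show ?thesis using c by (intro add_left_mono mult_left_mono) auto
  qed
  finally show ?case by (simp add: mult_ac c_def)
qed simp

lemma d2mpow_bound:
  assumes A: "norm (A :: real ^ 'n ^ 'n) \<le> R" and R: "1 \<le> R"
  shows "norm (d2mpow A H W k) \<le> norm (mat 1 :: real ^ 'n ^ 'n) * (4 * R) ^ k * norm H * norm W"
proof (induction k)
  case (Suc k)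
  define c where "c = norm (mat 1 :: real ^ 'n ^ 'n)"
  have c: "c \<ge> 0" by (simp add: c_def)
  have "norm (d2mpow A H W (Suc k))
      \<le> norm A * norm (d2mpow A H W k) + norm H * norm (dmpow A W k) + norm W * norm (dmpow A H k)"
    by (auto intro!: norm_triangle_le add_mono norm_matrix_mult_le)
  also have "\<dots> \<le> R * (c * (4 * R) ^ k * norm H * norm W)
      + norm H * (c * (2 * R) ^ k * norm W) + norm W * (c * (2 * R) ^ k * norm H)"
    unfolding c_def using R by (intro add_mono mult_mono Suc A dmpow_bound) auto
  also have "\<dots> = (R * (4 * R) ^ k + 2 * (2 * R) ^ k) * (c * norm H * norm W)"
    by (simp add: algebra_simps)
  \<comment> \<open>The three summands contribute at most \<open>3 * R * (4 * R) ^ k\<close>, so the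
    ratio \<open>4 * R\<close> leaves room.\<close>
  also have "\<dots> \<le> (4 * R) ^ Suc k * (c * norm H * norm W)"
  proof -
    have "(2 * R) ^ k \<le> (4 * R) ^ k" using R by (intro power_mono) auto
    moreover have "(4 * R) ^ k \<le> R * (4 * R) ^ k" using mult_right_mono[OF R, of "(4 * R) ^ k"] R by simp
    moreover have "0 \<le> R * (4 * R) ^ k" using R by simp
    ultimately have "R * (4 * R) ^ k + 2 * (2 * R) ^ k \<le> (4 * R) ^ Suc k"
      unfolding power_Suc mult.assoc by linarith
    then show ?thesis using c by (intro mult_right_mono) auto
  qed
  finally show ?case by (simp add: mult_ac c_def)
qed simp

lemma
  fixes A H :: "real ^ 'n ^ 'n"
  shows mexp_has_derivative: "(mexp has_derivative dmexp A) (at A)"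
  and summable_mexp: "summable (\<lambda>k. mpow A k /\<^sub>R fact k)"
  and summable_dmexp: "summable (\<lambda>k. dmpow A H k /\<^sub>R fact k)"
proof -
  have bd: "\<exists>C M. \<forall>k. \<forall>A :: real ^ 'n ^ 'n. norm A < R \<longrightarrow> norm (mpow A k) \<le> C * M ^ k
      \<and> (\<forall>H. norm (dmpow A H k) \<le> C * M ^ k * norm H)" for R
  proof (intro exI allI impI conjI)
    fix k and A H :: "real ^ 'n ^ 'n" assume A: "norm A < R"
    show "norm (dmpow A H k) \<le> norm (mat 1 :: real ^ 'n ^ 'n) * (2 * max 1 R) ^ k * norm H"
      using A by (intro dmpow_bound) auto
    show "norm (mpow A k) \<le> norm (mat 1 :: real ^ 'n ^ 'n) * (2 * max 1 R) ^ k"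
      using A by (intro mpow_bound) auto
  qed
  note D = exp_series_has_derivative[of "\<lambda>k A. mpow A k" "\<lambda>k A H. dmpow A H k", OF mpow_has_derivative bd]
  show "(mexp has_derivative dmexp A) (at A)"
    using D(1)[of A] unfolding mexp_def[abs_def] dmexp_def[abs_def] .
  show "summable (\<lambda>k. mpow A k /\<^sub>R fact k)" by (rule D(2))
  show "summable (\<lambda>k. dmpow A H k /\<^sub>R fact k)" by (rule D(3))
qed

lemma
  fixes A H W :: "real ^ 'n ^ 'n"
  shows dmexp_has_derivative: "((\<lambda>A. dmexp A W) has_derivative (\<lambda>H. d2mexp A H W)) (at A)"
  and summable_d2mexp: "summable (\<lambda>k. d2mpow A H W k /\<^sub>R fact k)"
proof -
  have bd: "\<exists>C M. \<forall>k. \<forall>A :: real ^ 'n ^ 'n. norm A < R \<longrightarrow> norm (dmpow A W k) \<le> C * M ^ k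
      \<and> (\<forall>H. norm (d2mpow A H W k) \<le> C * M ^ k * norm H)" for R
  proof (intro exI allI impI conjI)
    fix k and A H :: "real ^ 'n ^ 'n" assume A: "norm A < R"
    show "norm (d2mpow A H W k) \<le> (norm (mat 1 :: real ^ 'n ^ 'n) * norm W) * (4 * max 1 R) ^ k * norm H"
      using d2mpow_bound[of A "max 1 R" H W k] A by (simp add: mult_ac)
    \<comment> \<open>The bound is applied with twice the radius so that its ratio agrees with the
      one for \<open>d2mpow\<close>.\<close>
    have "norm (dmpow A W k) \<le> norm (mat 1 :: real ^ 'n ^ 'n) * (2 * (2 * max 1 R)) ^ k * norm W"
      using A by (intro dmpow_bound) auto
    then show "norm (dmpow A W k) \<le> (norm (mat 1 :: real ^ 'n ^ 'n) * norm W) * (4 * max 1 R) ^ k"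
      by (simp add: mult_ac)
  qed
  note D = exp_series_has_derivative[of "\<lambda>k A. dmpow A W k" "\<lambda>k A H. d2mpow A H W k",
      OF dmpow_has_derivative bd]
  show "((\<lambda>A. dmexp A W) has_derivative (\<lambda>H. d2mexp A H W)) (at A)"
    using D(1)[of A] unfolding d2mexp_def[abs_def] dmexp_def[abs_def] .
  show "summable (\<lambda>k. d2mpow A H W k /\<^sub>R fact k)" by (rule D(3))
qed

lemma d2mpow_commute: "d2mpow A H W k = d2mpow A W H k"
  by (induction k) (simp_all add: add_ac)

lemma d2mexp_commute: "d2mexp A H W = d2mexp A W H"
  by (simp add: d2mexp_def d2mpow_commute)

lemma linear_dmexp: "linear (dmexp A)"
  using mexp_has_derivative has_derivative_linear by blast

text \<open>Linearity in the direction of differentiation is automatic; symmetry carries it over to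
  the other argument.\<close>

lemma linear_d2mexp: "linear (d2mexp A H)"
proof -
  have "d2mexp A H = (\<lambda>W. d2mexp A W H)" by (rule ext) (rule d2mexp_commute)
  then show ?thesis using dmexp_has_derivative[of H A, THEN has_derivative_linear] by simp
qed

text \<open>Joint differentiability in the base point and the vector is reduced to fixed vectors by
  expanding the vector in the standard basis.\<close>

lemma dmexp_field_has_derivative:
  assumes F: "(F has_derivative F') (at x within S)" and G: "(G has_derivative G') (at x within S)"
  shows "((\<lambda>x. dmexp (F x) (G x)) has_derivative
    (\<lambda>h. d2mexp (F x) (F' h) (G x) + dmexp (F x) (G' h))) (at x within S)"
proof -
  have rep: "f W = (\<Sum>b\<in>Basis. (W \<bullet> b) *\<^sub>R f b)"
    if "linear f" for f :: "real ^ 'n ^ 'n \<Rightarrow> real ^ 'n ^ 'n" and W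
  proof -
    have "f W = f (\<Sum>b\<in>Basis. (W \<bullet> b) *\<^sub>R b)" by (simp add: euclidean_representation)
    also have "\<dots> = (\<Sum>b\<in>Basis. (W \<bullet> b) *\<^sub>R f b)" using that by (simp add: linear_sum linear_cmul)
    finally show ?thesis .
  qed
  have "((\<lambda>x. dmexp (F x) b) has_derivative (\<lambda>h. d2mexp (F x) (F' h) b)) (at x within S)" for b
    by (rule has_derivative_compose[OF F dmexp_has_derivative])
  then have "((\<lambda>x. \<Sum>b\<in>Basis. (G x \<bullet> b) *\<^sub>R dmexp (F x) b) has_derivative
      (\<lambda>h. \<Sum>b\<in>Basis. (G x \<bullet> b) *\<^sub>R d2mexp (F x) (F' h) b + (G' h \<bullet> b) *\<^sub>R dmexp (F x) b)) (at x within S)"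
    by (intro has_derivative_sum has_derivative_scaleR has_derivative_inner_left G)
  then show ?thesis
    by (simp add: sum.distrib rep[OF linear_dmexp, symmetric] rep[OF linear_d2mexp, symmetric])
qed

section \<open>Differential equations along \<open>t \<mapsto> mexp (t A)\<close>\<close>

lemmas mm_minus_left = bounded_bilinear.minus_left[OF bounded_bilinear_matrix_mult]
  and mm_minus_right = bounded_bilinear.minus_right[OF bounded_bilinear_matrix_mult]
  and mm_suminf = bounded_linear.suminf[OF bounded_bilinear.bounded_linear_right[OF bounded_bilinear_matrix_mult]]

lemma mpow_scaleR: "mpow (t *\<^sub>R A) k = t ^ k *\<^sub>R mpow A k"
  by (induction k) (simp_all add: mm_scaleR_left mm_scaleR_right)

lemma dmpow_scaleR: "dmpow (t *\<^sub>R A) (t *\<^sub>R W) k = t ^ k *\<^sub>R dmpow A W k"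
  by (induction k) (simp_all add: mm_scaleR_left mm_scaleR_right mpow_scaleR scaleR_add_right mult.commute)

lemma d2mpow_scaleR: "d2mpow (t *\<^sub>R A) (t *\<^sub>R H) (t *\<^sub>R W) k = t ^ k *\<^sub>R d2mpow A H W k"
  by (induction k) (simp_all add: mm_scaleR_left mm_scaleR_right dmpow_scaleR scaleR_add_right mult.commute)

text \<open>Scaling every argument by \<open>t\<close> pulls \<open>t ^ k\<close> out of the term of
  index \<open>k\<close>. Differentiation in \<open>t\<close> then shifts the index, and the
  recursion for the powers turns into a linear differential equation. The first and second
  variations below are treated in the same way.\<close>

lemma mexp_curve: "((\<lambda>t. mexp (t *\<^sub>R A)) has_vector_derivative A ** mexp (t *\<^sub>R A)) (at t)"
proof -
  have "((\<lambda>t. mexp (t *\<^sub>R A)) has_vector_derivative (\<Sum>k. (t ^ k *\<^sub>R mpow A (Suc k)) /\<^sub>R fact k)) (at t)"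
    unfolding mexp_def mpow_scaleR by (rule exp_series_has_vector_derivative[OF mpow_bound[OF order_refl]])
  also have "(\<Sum>k. (t ^ k *\<^sub>R mpow A (Suc k)) /\<^sub>R fact k) = A ** mexp (t *\<^sub>R A)"
    unfolding mexp_def mm_suminf[OF summable_mexp] by (simp add: mpow_scaleR mm_scaleR_right)
  finally show ?thesis .
qed

lemma dmexp_curve:
  fixes A W :: "real ^ 'n ^ 'n"
  shows "((\<lambda>t. dmexp (t *\<^sub>R A) (t *\<^sub>R W)) has_vector_derivative
    A ** dmexp (t *\<^sub>R A) (t *\<^sub>R W) + W ** mexp (t *\<^sub>R A)) (at t)"
proof -
  have bd: "norm (dmpow A W k) \<le> (norm (mat 1 :: real ^ 'n ^ 'n) * norm W) * (2 * max 1 (norm A)) ^ k" for k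
    using dmpow_bound[of A "max 1 (norm A)" W k] by (simp add: mult_ac)
  have "((\<lambda>t. dmexp (t *\<^sub>R A) (t *\<^sub>R W)) has_vector_derivative
      (\<Sum>k. (t ^ k *\<^sub>R dmpow A W (Suc k)) /\<^sub>R fact k)) (at t)"
    unfolding dmexp_def dmpow_scaleR by (rule exp_series_has_vector_derivative[OF bd])
  also have "(\<Sum>k. (t ^ k *\<^sub>R dmpow A W (Suc k)) /\<^sub>R fact k)
      = A ** dmexp (t *\<^sub>R A) (t *\<^sub>R W) + W ** mexp (t *\<^sub>R A)"
  proof -
    have s: "summable (\<lambda>k. A ** (dmpow (t *\<^sub>R A) (t *\<^sub>R W) k /\<^sub>R fact k))"
      "summable (\<lambda>k. W ** (mpow (t *\<^sub>R A) k /\<^sub>R fact k))"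
      by (intro bounded_linear.summable[OF bounded_bilinear.bounded_linear_right[OF bounded_bilinear_matrix_mult]]
          summable_dmexp summable_mexp)+
    show ?thesis
      unfolding mexp_def dmexp_def mm_suminf[OF summable_mexp] mm_suminf[OF summable_dmexp] suminf_add[OF s]
      by (simp add: mpow_scaleR dmpow_scaleR mm_scaleR_right scaleR_add_right)
  qed
  finally show ?thesis .
qed

lemma d2mexp_curve:
  fixes A H W :: "real ^ 'n ^ 'n"
  shows "((\<lambda>t. d2mexp (t *\<^sub>R A) (t *\<^sub>R H) (t *\<^sub>R W)) has_vector_derivative
    A ** d2mexp (t *\<^sub>R A) (t *\<^sub>R H) (t *\<^sub>R W)
    + H ** dmexp (t *\<^sub>R A) (t *\<^sub>R W) + W ** dmexp (t *\<^sub>R A) (t *\<^sub>R H)) (at t)"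
proof -
  have bd: "norm (d2mpow A H W k)
      \<le> (norm (mat 1 :: real ^ 'n ^ 'n) * norm H * norm W) * (4 * max 1 (norm A)) ^ k" for k
    using d2mpow_bound[of A "max 1 (norm A)" H W k] by (simp add: mult_ac)
  have "((\<lambda>t. d2mexp (t *\<^sub>R A) (t *\<^sub>R H) (t *\<^sub>R W)) has_vector_derivative
      (\<Sum>k. (t ^ k *\<^sub>R d2mpow A H W (Suc k)) /\<^sub>R fact k)) (at t)"
    unfolding d2mexp_def d2mpow_scaleR by (rule exp_series_has_vector_derivative[OF bd])
  also have "(\<Sum>k. (t ^ k *\<^sub>R d2mpow A H W (Suc k)) /\<^sub>R fact k)
      = A ** d2mexp (t *\<^sub>R A) (t *\<^sub>R H) (t *\<^sub>R W)
        + H ** dmexp (t *\<^sub>R A) (t *\<^sub>R W) + W ** dmexp (t *\<^sub>R A) (t *\<^sub>R H)"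
  proof -
    have s: "summable (\<lambda>k. A ** (d2mpow (t *\<^sub>R A) (t *\<^sub>R H) (t *\<^sub>R W) k /\<^sub>R fact k))"
      "summable (\<lambda>k. H ** (dmpow (t *\<^sub>R A) (t *\<^sub>R W) k /\<^sub>R fact k))"
      "summable (\<lambda>k. W ** (dmpow (t *\<^sub>R A) (t *\<^sub>R H) k /\<^sub>R fact k))"
      by (intro bounded_linear.summable[OF bounded_bilinear.bounded_linear_right[OF bounded_bilinear_matrix_mult]]
          summable_dmexp summable_d2mexp)+
    show ?thesis
      unfolding dmexp_def d2mexp_def mm_suminf[OF summable_dmexp] mm_suminf[OF summable_d2mexp]
        suminf_add[OF s(1,2)] suminf_add[OF summable_add[OF s(1,2)] s(3)]
      by (simp add: dmpow_scaleR d2mpow_scaleR mm_scaleR_right scaleR_add_right)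
  qed
  finally show ?thesis .
qed

section \<open>Exponentials of skew-symmetric matrices are rotations\<close>

lemma mpow_Suc_right: "mpow A (Suc k) = mpow A k ** A"
proof (induction k)
  case (Suc k)
  have "mpow A (Suc (Suc k)) = A ** (mpow A k ** A)" using Suc by simp
  then show ?case by (simp add: matrix_mul_assoc)
qed simp

lemma mexp_scaleR_commute: "A ** mexp (t *\<^sub>R A) = mexp (t *\<^sub>R A) ** A"
proof -
  have "A ** mpow (t *\<^sub>R A) k = mpow (t *\<^sub>R A) k ** A" for k
    using mpow_Suc_right[of A k] by (simp add: mpow_scaleR mm_scaleR_left mm_scaleR_right)
  then show ?thesis
    unfolding mexp_def mm_suminf[OF summable_mexp]
      bounded_linear.suminf[OF bounded_bilinear.bounded_linear_left[OF bounded_bilinear_matrix_mult] summable_mexp]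
    by (simp add: mm_scaleR_left mm_scaleR_right)
qed

lemma transpose_mexp: "transpose (mexp A) = mexp (transpose A)"
proof -
  have "transpose (mpow A k) = mpow (transpose A) k" for k
    by (induction k) (simp_all add: mpow_Suc_right[unfolded mpow.simps] matrix_transpose_mul)
  then show ?thesis
    unfolding mexp_def bounded_linear.suminf[OF bounded_linear_transpose summable_mexp]
    by (simp add: tr_scaleR)
qed

lemma mexp_0: "mexp (0 :: real ^ 'n ^ 'n) = mat 1"
proof -
  have "(\<lambda>k. mpow (0 :: real ^ 'n ^ 'n) k /\<^sub>R fact k) = (\<lambda>k. if k = 0 then mat 1 else 0)"
  proof
    show "mpow (0 :: real ^ 'n ^ 'n) k /\<^sub>R fact k = (if k = 0 then mat 1 else 0)" for k
      by (cases k) (simp_all add: mm_zero_left)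
  qed
  then show ?thesis
    unfolding mexp_def by (simp only: sums_single[of 0 "\<lambda>_. mat 1", THEN sums_unique, symmetric])
qed

text \<open>The same product with \<open>t A\<close> in place of \<open>A\<close> has zero
  derivative in \<open>t\<close>, because \<open>A\<close> commutes with its exponentials, and
  equals \<open>mat 1\<close> at \<open>t = 0\<close>.\<close>

lemma mexp_minus_mult: "mexp (- A) ** mexp A = mat 1"
proof -
  let ?f = "\<lambda>t. mexp (t *\<^sub>R (- A)) ** mexp (t *\<^sub>R A)"
  have "(?f has_vector_derivative 0) (at t)" for t
    using mm_has_vector_derivative[OF mexp_curve[of "- A" t] mexp_curve[of A t]]
    by (simp only: mexp_scaleR_commute[of "- A"]) (simp add: mm_minus_left mm_minus_right matrix_mul_assoc)
  then obtain c where c: "\<And>t. ?f t = c"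
    by (rule has_vector_derivative_zero_constant[of UNIV ?f, OF convex_UNIV]) auto
  have "?f 1 = ?f 0" by (simp only: c)
  then show ?thesis by (simp add: mexp_0)
qed

lemma mexp_skew_orthogonal:
  assumes "transpose A = - A"
  shows "transpose (mexp A) ** mexp A = mat 1"
  by (simp add: transpose_mexp assms mexp_minus_mult)

text \<open>Along \<open>t A\<close> the determinant is continuous, takes only the values 1 and -1
  and starts at 1; reaching -1 would force a zero in between.\<close>

lemma mexp_skew_in_SO:
  assumes A: "transpose A = - A"
  shows "mexp A \<in> SO"
proof -
  have o: "transpose (mexp (t *\<^sub>R A)) ** mexp (t *\<^sub>R A) = mat 1" for t
    by (rule mexp_skew_orthogonal) (simp add: tr_scaleR A)
  then have d: "det (mexp (t *\<^sub>R A)) = 1 \<or> det (mexp (t *\<^sub>R A)) = - 1" for t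
    by (intro det_orthogonal_matrix) (simp add: orthogonal_matrix)
  have "continuous_on UNIV (\<lambda>t. mexp (t *\<^sub>R A))"
    using mexp_curve has_vector_derivative_continuous by (blast intro: continuous_at_imp_continuous_on)
  then have c: "continuous_on {0..1} (\<lambda>t. det (mexp (t *\<^sub>R A)))"
    unfolding det_def
    by (intro continuous_on_sum continuous_on_mult continuous_on_prod continuous_on_const continuous_on_component)
       (rule continuous_on_subset, auto)
  have "det (mexp A) \<noteq> - 1"
  proof
    assume "det (mexp A) = - 1"
    then have "\<exists>t\<ge>0. t \<le> 1 \<and> det (mexp (t *\<^sub>R A)) = 0"
      by (intro IVT2' c) (simp_all add: mexp_0)
    then obtain t where "det (mexp (t *\<^sub>R A)) = 0" by blast
    then show False using d[of t] by simp
  qed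
  then show ?thesis using d[of 1] o[of 1] by (simp add: SO_iff)
qed

section \<open>The skew part of the second derivative\<close>

text \<open>In the left trivialisation the two variations of \<open>t \<mapsto> mexp (t A)\<close> become skew-symmetric
  matrices \<open>\<Omega>\<^sub>i\<close> with \<open>\<Omega>\<^sub>i' = a\<^sub>i\<close>, where \<open>a\<^sub>i\<close> is the conjugate of \<open>W\<^sub>i\<close>, and twice the skew part
  of the second variation has derivative \<open>[a\<^sub>1, \<Omega>\<^sub>2] + [a\<^sub>2, \<Omega>\<^sub>1]\<close>. This is unchanged when
  \<open>t a\<^sub>i\<close> is subtracted from \<open>\<Omega>\<^sub>i\<close>, and the difference is of second order in \<open>t\<close>.\<close>

lemma skew_part_d2mexp_bound:
  fixes A W1 W2 :: "real ^ 'n ^ 'n"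
  assumes A: "transpose A = - A" and W1: "transpose W1 = - W1" and W2: "transpose W2 = - W2"
  defines "P \<equiv> transpose (mexp A) ** d2mexp A W1 W2"
  shows "norm (P - transpose P) \<le> 2 / 3 * norm A * norm W1 * norm W2"
proof -
  define g where "g t = mexp (t *\<^sub>R A)" for t
  define h where "h t = mexp (t *\<^sub>R (- A))" for t
  have hg: "h t = transpose (g t)" for t by (simp add: g_def h_def transpose_mexp tr_scaleR A)
  have hg1: "h t ** g t = mat 1" for t
    unfolding hg g_def by (rule mexp_skew_orthogonal) (simp add: tr_scaleR A)
  then have gh1: "g t ** h t = mat 1" for t by (simp add: matrix_left_right_inverse)
  have trh: "transpose (h t) = g t" for t by (simp add: hg)
  have dg: "(g has_vector_derivative A ** g t) (at t)" for t
    unfolding g_def[abs_def] by (rule mexp_curve)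
  have dh: "(h has_vector_derivative - (h t ** A)) (at t)" for t
    using mexp_curve[of "- A" t] unfolding h_def[abs_def] mexp_scaleR_commute[of "- A"]
    by (simp add: mm_minus_right)
  \<comment> \<open>Conjugation by the rotation \<open>g t\<close> preserves the norm and
    skew-symmetry. \<open>J\<close> is the variation of \<open>g\<close> caused by varying
    \<open>A\<close> in the direction \<open>W\<close>, and \<open>\<Omega>\<close> is its left
    translate to the identity.\<close>
  define a where "a W t = h t ** W ** g t" for W t
  define J where "J W t = dmexp (t *\<^sub>R A) (t *\<^sub>R W)" for W t
  define \<Omega> where "\<Omega> W t = h t ** J W t" for W t
  have da: "(a W has_vector_derivative a (W ** A - A ** W) t) (at t)" for W t
    using mm_has_vector_derivative[OF mm_has_vector_derivative[OF dh[of t] has_vector_derivative_const[of W]] dg[of t]]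
    unfolding a_def[abs_def]
    by (simp add: mm_diff_left mm_diff_right mm_minus_left mm_zero_right matrix_mul_assoc)
  have dJ: "(J W has_vector_derivative A ** J W t + W ** g t) (at t)" for W t
    unfolding J_def[abs_def] g_def by (rule dmexp_curve)
  \<comment> \<open>The terms containing \<open>A\<close> from \<open>h'\<close> and from
    \<open>J'\<close> cancel.\<close>
  have d\<Omega>: "(\<Omega> W has_vector_derivative a W t) (at t)" for W t
    using mm_has_vector_derivative[OF dh[of t] dJ[of W t]]
    unfolding \<Omega>_def[abs_def] a_def
    by (simp add: mm_add_right mm_minus_left matrix_mul_assoc)
  have norm_a: "norm (a W t) = norm W" for W t
    using norm_mult_orthogonal[of "h t"] norm_mult_orthogonal[of "g t"] hg1 gh1
    by (simp add: a_def trh hg[symmetric])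
  have \<Omega>0: "\<Omega> W 0 = 0" for W by (simp add: \<Omega>_def J_def linear_0[OF linear_dmexp] mm_zero_right)
  have a_skew: "transpose (a W t) = - a W t" if "transpose W = - W" for W t
    by (simp add: a_def matrix_transpose_mul trh hg[symmetric] that mm_minus_left mm_minus_right matrix_mul_assoc)
  \<comment> \<open>The symmetric part has derivative zero and vanishes at 0.\<close>
  have \<Omega>_skew: "transpose (\<Omega> W t) = - \<Omega> W t" if W: "transpose W = - W" for W t
  proof -
    have "((\<lambda>t. \<Omega> W t + transpose (\<Omega> W t)) has_vector_derivative 0) (at t)" for t
      using has_vector_derivative_add[OF d\<Omega>[of W t] tr_has_vector_derivative[OF d\<Omega>[of W t]]] by (simp add: a_skew W)
    then obtain c where "\<And>t. \<Omega> W t + transpose (\<Omega> W t) = c"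
      by (rule has_vector_derivative_zero_constant[of UNIV "\<lambda>t. \<Omega> W t + transpose (\<Omega> W t)", OF convex_UNIV]) auto
    then have "\<Omega> W t + transpose (\<Omega> W t) = \<Omega> W 0 + transpose (\<Omega> W 0)" by simp
    then show ?thesis by (simp add: \<Omega>0 tr_zero eq_neg_iff_add_eq_0 add.commute)
  qed
  \<comment> \<open>In the derivative \<open>a W t\<close> cancels, leaving \<open>- t\<close> times
    the conjugated commutator of \<open>W\<close> and \<open>A\<close>; its bound is integrated from
    0.\<close>
  have D_bound: "norm (\<Omega> W t - t *\<^sub>R a W t) \<le> sqrt 2 * norm A * norm W * t\<^sup>2 / 2" if t: "0 < t" for W t
  proof -
    let ?D = "\<lambda>t. \<Omega> W t - t *\<^sub>R a W t" and ?\<phi> = "\<lambda>t. sqrt 2 * norm A * norm W * t\<^sup>2 / 2"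
    have dD: "(?D has_vector_derivative - (s *\<^sub>R a (W ** A - A ** W) s)) (at s)" for s
      using has_vector_derivative_diff[OF d\<Omega>[of W s] has_vector_derivative_scaleR[OF DERIV_ident da[of W s]]] by simp
    have d\<phi>: "(?\<phi> has_vector_derivative sqrt 2 * norm A * norm W * s) (at s)" for s
      unfolding has_real_derivative_iff_has_vector_derivative[symmetric]
      by (auto intro!: derivative_eq_intros)
    have "norm (?D t - ?D 0) \<le> ?\<phi> t - ?\<phi> 0"
    proof (rule differentiable_bound_general[OF t _ _ dD d\<phi>])
      show "continuous_on {0..t} ?D"
        using dD has_vector_derivative_continuous by (blast intro: continuous_at_imp_continuous_on)
      show "continuous_on {0..t} ?\<phi>" by (intro continuous_intros) simp
      fix s :: real assume s: "0 < s" "s < t"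
      have "norm (- (s *\<^sub>R a (W ** A - A ** W) s)) = s * norm (A ** W - W ** A)"
        using s by (simp add: norm_a norm_minus_commute)
      also have "\<dots> \<le> s * (sqrt 2 * norm A * norm W)"
        using s by (intro mult_left_mono norm_skew_commutator A) auto
      finally show "norm (- (s *\<^sub>R a (W ** A - A ** W) s)) \<le> sqrt 2 * norm A * norm W * s"
        by (simp add: mult_ac)
    qed
    then show ?thesis by (simp add: \<Omega>0)
  qed
  define D where "D W t = \<Omega> W t - t *\<^sub>R a W t" for W t
  define C where "C X Y = X ** Y - Y ** X" for X Y :: "real ^ 'n ^ 'n"
  define Q where "Q t = h t ** d2mexp (t *\<^sub>R A) (t *\<^sub>R W1) (t *\<^sub>R W2)" for t
  \<comment> \<open>The factor \<open>g t ** h t = mat 1\<close> is inserted between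
    \<open>W\<close> and \<open>J V t\<close>.\<close>
  have hWJ: "h t ** (W ** J V t) = a W t ** \<Omega> V t" for W V t
  proof -
    have "a W t ** \<Omega> V t = h t ** W ** (g t ** h t) ** J V t" by (simp add: a_def \<Omega>_def matrix_mul_assoc)
    then show ?thesis by (simp add: gh1 matrix_mul_assoc)
  qed
  have dQ: "(Q has_vector_derivative a W1 t ** \<Omega> W2 t + a W2 t ** \<Omega> W1 t) (at t)" for t
    using mm_has_vector_derivative[OF dh[of t] d2mexp_curve[of A W1 W2 t]]
    unfolding Q_def[abs_def] J_def[symmetric] mm_add_right hWJ
    by (simp add: mm_minus_left matrix_mul_assoc)
  \<comment> \<open>Replacing \<open>\<Omega>\<close> by \<open>D\<close> alters the two commutators
    by \<open>t C (a W1 t) (a W2 t)\<close> and \<open>t C (a W2 t) (a W1 t)\<close>, which add up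
    to zero.\<close>
  have dS: "((\<lambda>t. Q t - transpose (Q t)) has_vector_derivative
      C (a W1 t) (D W2 t) + C (a W2 t) (D W1 t)) (at t)" for t
  proof -
    have "transpose (a W1 t ** \<Omega> W2 t + a W2 t ** \<Omega> W1 t) = \<Omega> W2 t ** a W1 t + \<Omega> W1 t ** a W2 t"
      by (simp add: tr_add matrix_transpose_mul a_skew \<Omega>_skew W1 W2 mm_minus_left mm_minus_right)
    moreover have "a W1 t ** \<Omega> W2 t + a W2 t ** \<Omega> W1 t - (\<Omega> W2 t ** a W1 t + \<Omega> W1 t ** a W2 t)
        = C (a W1 t) (D W2 t) + C (a W2 t) (D W1 t)"
      unfolding C_def D_def
      by (simp add: mm_diff_left mm_diff_right mm_scaleR_left mm_scaleR_right)
    ultimately show ?thesis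
      using has_vector_derivative_diff[OF dQ[of t] tr_has_vector_derivative[OF dQ[of t]]] by simp
  qed
  \<comment> \<open>An antiderivative of the bound
    \<open>2 * norm A * norm W1 * norm W2 * t\<^sup>2\<close>, to which each of the two commutators
    contributes half.\<close>
  let ?\<psi> = "\<lambda>t. 2 / 3 * norm A * norm W1 * norm W2 * t ^ 3"
  have d\<psi>: "(?\<psi> has_vector_derivative 2 * norm A * norm W1 * norm W2 * t\<^sup>2) (at t)" for t
    unfolding has_real_derivative_iff_has_vector_derivative[symmetric]
    by (auto intro!: derivative_eq_intros)
  have "norm ((Q 1 - transpose (Q 1)) - (Q 0 - transpose (Q 0))) \<le> ?\<psi> 1 - ?\<psi> 0"
  proof (rule differentiable_bound_general[OF zero_less_one _ _ dS d\<psi>])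
    show "continuous_on {0..1} (\<lambda>t. Q t - transpose (Q t))"
      using dS has_vector_derivative_continuous by (blast intro: continuous_at_imp_continuous_on)
    show "continuous_on {0..1} ?\<psi>" by (intro continuous_intros)
    fix t :: real assume t: "0 < t" "t < 1"
    have CD: "norm (C (a W t) (D V t)) \<le> norm A * norm W * norm V * t\<^sup>2" if "transpose W = - W" for W V
    proof -
      have "norm (C (a W t) (D V t)) \<le> sqrt 2 * norm (a W t) * norm (D V t)"
        unfolding C_def by (rule norm_skew_commutator[OF a_skew[OF that]])
      also have "\<dots> \<le> sqrt 2 * norm W * (sqrt 2 * norm A * norm V * t\<^sup>2 / 2)"
        unfolding norm_a D_def by (intro mult_left_mono D_bound t) simp
      also have "\<dots> = (sqrt 2 * sqrt 2) / 2 * (norm A * norm W * norm V * t\<^sup>2)"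
        by (simp only: times_divide_eq_left times_divide_eq_right mult_ac)
      finally show ?thesis by simp
    qed
    show "norm (C (a W1 t) (D W2 t) + C (a W2 t) (D W1 t)) \<le> 2 * norm A * norm W1 * norm W2 * t\<^sup>2"
      using norm_triangle_le[OF add_mono[OF CD[OF W1, of W2] CD[OF W2, of W1]]] by (simp add: mult_ac)
  qed
  moreover have "Q 0 = 0" by (simp add: Q_def linear_0[OF linear_d2mexp] mm_zero_right)
  moreover have "Q 1 = P" using hg[of 1] by (simp add: Q_def P_def g_def)
  ultimately show ?thesis by (simp add: tr_zero)
qed

section \<open>Geodesics and the exponential map of the rotation group\<close>

lemma SO_mult_transpose: "p \<in> SO \<Longrightarrow> p ** transpose p = mat 1"
  by (simp add: SO_iff matrix_left_right_inverse)

lemma SO_mult: "p \<in> SO \<Longrightarrow> q \<in> SO \<Longrightarrow> p ** q \<in> SO"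
  by (simp add: SO_def rotation_matrix_def orthogonal_matrix_mul det_mul)

lemma tangent_space_SO_iff:
  fixes p :: "real ^ 'n ^ 'n"
  assumes "p \<in> SO"
  shows "x \<in> tangent_space SO p \<longleftrightarrow> transpose (transpose p ** x) = - (transpose p ** x)"
  using assms by (auto simp: tangent_space_SO matrix_transpose_mul eq_neg_iff_add_eq_0 add.commute)

lemma inner_transpose: "transpose A \<bullet> B = A \<bullet> transpose (B :: real ^ 'n ^ 'm)"
  by (simp add: inner_vec_def transpose_def) (rule sum.swap)

lemma inner_mult_orthogonal:
  fixes Q A B :: "real ^ 'n ^ 'n"
  assumes Q: "transpose Q ** Q = mat 1"
  shows "(Q ** A) \<bullet> (Q ** B) = A \<bullet> B"
  by (simp add: dot_norm mm_add_right[symmetric] norm_mult_orthogonal[OF Q])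

text \<open>The tangent space at \<open>q\<close> consists of \<open>q\<close> times skew-symmetric
  matrices, and these are orthogonal to \<open>q\<close> times symmetric ones; so projecting keeps
  the skew part of \<open>K\<close>.\<close>

lemma orth_proj_SO:
  fixes q :: "real ^ 'n ^ 'n"
  assumes q: "q \<in> SO"
  shows "orth_proj (tangent_space SO q) (q ** K) = (1 / 2) *\<^sub>R (q ** (K - transpose K))"
proof (rule orth_proj_eqI[OF subspace_tangent_space_SO[OF q]])
  have qq: "transpose q ** q = mat 1" using q by (simp add: SO_iff)
  then show "(1 / 2) *\<^sub>R (q ** (K - transpose K)) \<in> tangent_space SO q"
    unfolding tangent_space_SO_iff[OF q]
    by (simp add: mm_scaleR_right tr_scaleR matrix_mul_assoc tr_diff scaleR_diff_right)
  fix z assume "z \<in> tangent_space SO q"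
  then have Z: "transpose (transpose q ** z) = - (transpose q ** z)" by (simp add: tangent_space_SO_iff q)
  define Z where "Z = transpose q ** z"
  have z: "z = q ** Z" by (simp add: Z_def matrix_mul_assoc SO_mult_transpose q)
  have "transpose K \<bullet> Z = - (K \<bullet> Z)" using Z by (simp add: inner_transpose Z_def)
  then show "((1 / 2) *\<^sub>R (q ** (K - transpose K))) \<bullet> z = (q ** K) \<bullet> z"
    unfolding z by (simp add: inner_mult_orthogonal[OF qq] inner_diff_left)
qed

text \<open>The acceleration is the curve times \<open>A ** A\<close>; this square is symmetric,
  hence the acceleration is normal.\<close>

lemma geodesic_mexp:
  fixes p A :: "real ^ 'n ^ 'n"
  assumes p: "p \<in> SO" and A: "transpose A = - A"
  shows "geodesic SO (\<lambda>t. p ** mexp (t *\<^sub>R A))"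
    and "((\<lambda>t. p ** mexp (t *\<^sub>R A)) has_vector_derivative p ** A) (at 0)"
proof -
  let ?\<gamma> = "\<lambda>t. p ** mexp (t *\<^sub>R A)"
  have d1: "(?\<gamma> has_vector_derivative ?\<gamma> t ** A) (at t)" for t
    using mm_has_vector_derivative[OF has_vector_derivative_const[of p] mexp_curve[of A t]]
    by (simp add: mm_zero_left mexp_scaleR_commute matrix_mul_assoc)
  have d2: "((\<lambda>t. ?\<gamma> t ** A) has_vector_derivative ?\<gamma> t ** (A ** A)) (at t)" for t
    using mm_has_vector_derivative[OF d1[of t] has_vector_derivative_const[of A]]
    by (simp add: mm_zero_right matrix_mul_assoc)
  have SO: "?\<gamma> t \<in> SO" for t
    by (intro SO_mult p mexp_skew_in_SO) (simp add: tr_scaleR A)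
  have "pullback_LC SO UNIV ?\<gamma> (\<lambda>t. ?\<gamma> t ** A) t 1 = 0" for t
  proof -
    have "frechet_derivative (\<lambda>t. ?\<gamma> t ** A) (at t) 1 = ?\<gamma> t ** (A ** A)"
      using frechet_derivative_at[OF d2[of t, unfolded has_vector_derivative_def]] by (metis scaleR_one)
    moreover have "transpose (A ** A) = A ** A"
      by (simp add: matrix_transpose_mul A mm_minus_left mm_minus_right)
    ultimately show ?thesis
      by (simp add: pullback_LC_def orth_proj_SO[OF SO] mm_zero_right)
  qed
  moreover have "(\<lambda>t. ?\<gamma> t ** A) differentiable at t" for t
    using d2 by (rule differentiableI_vector)
  ultimately show "geodesic SO ?\<gamma>"
    unfolding geodesic_def using SO d1 by (intro conjI allI exI[of _ "\<lambda>t. ?\<gamma> t ** A"]) blast+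
  show "(?\<gamma> has_vector_derivative p ** A) (at 0)"
    using d1[of 0] by (simp add: mexp_0)
qed

text \<open>The body velocity \<open>B = \<gamma>\<^sup>T \<gamma>'\<close> of a geodesic is constant: \<open>B'\<close> is skew-symmetric because \<open>B\<close> is,
  and symmetric by the geodesic equation.\<close>

lemma geodesic_SO_unique:
  fixes \<gamma> :: "real \<Rightarrow> real ^ 'n ^ 'n"
  assumes "geodesic SO \<gamma>" and \<gamma>0: "\<gamma> 0 = p" "(\<gamma> has_vector_derivative v) (at 0)"
  shows "\<gamma> t = p ** mexp (t *\<^sub>R (transpose p ** v))"
proof -
  obtain \<gamma>' where SO: "\<And>t. \<gamma> t \<in> SO" and d\<gamma>: "\<And>t. (\<gamma> has_vector_derivative \<gamma>' t) (at t)"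
    and diff: "\<And>t. \<gamma>' differentiable at t" and eq: "\<And>t. pullback_LC SO UNIV \<gamma> \<gamma>' t 1 = 0"
    using assms(1) unfolding geodesic_def by blast
  define \<gamma>'' where "\<gamma>'' t = vector_derivative \<gamma>' (at t)" for t
  have d\<gamma>': "(\<gamma>' has_vector_derivative \<gamma>'' t) (at t)" for t
    using diff[of t] by (simp add: \<gamma>''_def vector_derivative_works)
  then have fr: "frechet_derivative \<gamma>' (at t) 1 = \<gamma>'' t" for t
    using frechet_derivative_at[of \<gamma>' "\<lambda>h. h *\<^sub>R \<gamma>'' t" t]
    by (metis has_vector_derivative_def scaleR_one)
  define B where "B t = transpose (\<gamma> t) ** \<gamma>' t" for t
  define K where "K t = transpose (\<gamma> t) ** \<gamma>'' t" for t
  have o: "transpose (\<gamma> t) ** \<gamma> t = mat 1" for t using SO[of t] by (simp add: SO_iff)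
  \<comment> \<open>Tangent vectors are velocities at parameter 0, so the curve is first shifted by
    \<open>t\<close>.\<close>
  have B_skew: "transpose (B t) = - B t" for t
  proof -
    have "((\<lambda>s. \<gamma> (t + s)) has_vector_derivative \<gamma>' t) (at 0)"
    proof -
      have "((\<lambda>s. t + s) has_vector_derivative 1) (at 0)"
        by (auto intro!: derivative_eq_intros simp: has_real_derivative_iff_has_vector_derivative[symmetric])
      from vector_diff_chain_at[OF this, of \<gamma> "\<gamma>' t"] show ?thesis
        using d\<gamma>[of t] by (simp add: o_def)
    qed
    then have "\<gamma>' t \<in> tangent_space SO (\<gamma> t)"
      unfolding tangent_space_def using SO by (intro CollectI exI[of _ "\<lambda>s. \<gamma> (t + s)"]) simp
    then show ?thesis by (simp add: tangent_space_SO_iff[OF SO] B_def)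
  qed
  have K_sym: "transpose (K t) = K t" for t
  proof -
    have "\<gamma>'' t = \<gamma> t ** K t" by (simp add: K_def matrix_mul_assoc SO_mult_transpose SO)
    then have "\<gamma> t ** (K t - transpose (K t)) = 0"
      using eq[of t] orth_proj_SO[OF SO[of t], of "K t"] by (simp add: pullback_LC_def fr)
    then have "norm (K t - transpose (K t)) = 0"
      using norm_mult_orthogonal(1)[OF o[of t]] by (metis norm_zero)
    then show ?thesis by simp
  qed
  have dB: "(B has_vector_derivative K t + transpose (\<gamma>' t) ** \<gamma>' t) (at t)" for t
    unfolding B_def[abs_def] K_def
    by (rule mm_has_vector_derivative[OF tr_has_vector_derivative[OF d\<gamma>] d\<gamma>'])
  \<comment> \<open>The derivative of \<open>B\<close> is symmetric by \<open>K_sym\<close>, while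
    \<open>B + transpose B\<close> is identically zero; hence twice the derivative vanishes.\<close>
  have "(B has_vector_derivative 0) (at t)" for t
  proof -
    have "((\<lambda>t. B t + transpose (B t)) has_vector_derivative
        2 *\<^sub>R (K t + transpose (\<gamma>' t) ** \<gamma>' t)) (at t)"
      using has_vector_derivative_add[OF dB[of t] tr_has_vector_derivative[OF dB[of t]]]
      by (simp add: tr_add K_sym matrix_transpose_mul scaleR_2)
    moreover have "((\<lambda>t. B t + transpose (B t)) has_vector_derivative 0) (at t)"
      by (simp add: B_skew)
    ultimately have "2 *\<^sub>R (K t + transpose (\<gamma>' t) ** \<gamma>' t) = 0"
      by (rule vector_derivative_unique_at)
    then show ?thesis using dB[of t] by simp
  qed
  then obtain c where c: "\<And>t. B t = c"
    by (rule has_vector_derivative_zero_constant[of UNIV B, OF convex_UNIV]) auto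
  have "\<gamma>' 0 = v" using d\<gamma>[of 0] \<gamma>0(2) by (rule vector_derivative_unique_at)
  then have c_eq: "c = transpose p ** v" using c[of 0] \<gamma>0(1) by (simp add: B_def)
  have \<gamma>'_eq: "\<gamma>' t = \<gamma> t ** c" for t
    using c[of t] SO_mult_transpose[OF SO[of t]] by (metis B_def matrix_mul_assoc matrix_mul_lid)
  let ?h = "\<lambda>t. mexp (t *\<^sub>R (- c))"
  \<comment> \<open>Integrating factor for the linear equation
    \<open>\<gamma>' = \<gamma> c\<close>.\<close>
  have "((\<lambda>t. \<gamma> t ** ?h t) has_vector_derivative 0) (at t)" for t
    using mm_has_vector_derivative[OF d\<gamma>[of t] mexp_curve[of "- c" t]]
    by (simp add: \<gamma>'_eq mm_minus_left mm_minus_right matrix_mul_assoc)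
  then obtain k where k: "\<And>t. \<gamma> t ** ?h t = k"
    by (rule has_vector_derivative_zero_constant[of UNIV "\<lambda>t. \<gamma> t ** ?h t", OF convex_UNIV]) auto
  have "k = p" using k[of 0] by (simp add: mexp_0 \<gamma>0)
  have "\<gamma> t = \<gamma> t ** (?h t ** mexp (t *\<^sub>R c))"
    using mexp_minus_mult[of "t *\<^sub>R c"] by simp
  also have "\<dots> = p ** mexp (t *\<^sub>R c)" using k[of t] \<open>k = p\<close> by (simp add: matrix_mul_assoc)
  finally show ?thesis by (simp only: c_eq)
qed

lemma riem_exp_SO:
  fixes p v :: "real ^ 'n ^ 'n"
  assumes p: "p \<in> SO" and v: "v \<in> tangent_space SO p"
  shows "riem_exp SO p v = p ** mexp (transpose p ** v)"
  unfolding riem_exp_def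
proof (rule the_equality)
  let ?A = "transpose p ** v"
  have A: "transpose ?A = - ?A" using v tangent_space_SO_iff[OF p] by blast
  have "p ** ?A = v" by (simp add: matrix_mul_assoc SO_mult_transpose p)
  with geodesic_mexp[OF p A]
  show "\<exists>\<gamma>. geodesic SO \<gamma> \<and> \<gamma> 0 = p \<and> (\<gamma> has_vector_derivative v) (at 0) \<and> \<gamma> 1 = p ** mexp ?A"
    by (intro exI[of _ "\<lambda>t. p ** mexp (t *\<^sub>R ?A)"]) (simp add: mexp_0)
next
  fix q assume "\<exists>\<gamma>. geodesic SO \<gamma> \<and> \<gamma> 0 = p \<and> (\<gamma> has_vector_derivative v) (at 0) \<and> \<gamma> 1 = q"
  then show "q = p ** mexp (transpose p ** v)" using geodesic_SO_unique[of _ p v 1] by auto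
qed

section \<open>The differential and the Hessian of the exponential map\<close>

lemma subspace_subset_tangent_space:
  assumes N: "subspace N" and x: "x \<in> N" and w: "w \<in> N"
  shows "w \<in> tangent_space N x"
  unfolding tangent_space_def
proof (intro CollectI exI conjI allI)
  show "x + t *\<^sub>R w \<in> N" for t using assms by (simp add: subspace_add subspace_scale)
  show "((\<lambda>t. x + t *\<^sub>R w) has_vector_derivative w) (at 0)"
    by (auto intro!: derivative_eq_intros)
qed simp

lemma orth_proj_add:
  assumes S: "subspace S" and b: "b \<in> S"
  shows "orth_proj S (a + b) = orth_proj S a + b"
  using b by (intro orth_proj_eqI[OF S] subspace_add[OF S] orth_proj_in[OF S])
    (simp_all add: inner_add_left orth_proj_inner[OF S])

lemma riem_exp_SO_has_derivative:
  fixes p :: "real ^ 'n ^ 'n"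
  assumes p: "p \<in> SO" and x: "x \<in> tangent_space SO p"
  shows "(riem_exp SO p has_derivative (\<lambda>w. p ** dmexp (transpose p ** x) (transpose p ** w)))
    (at x within tangent_space SO p)"
proof (rule has_derivative_transform[OF x riem_exp_SO[OF p]])
  show "((\<lambda>x. p ** mexp (transpose p ** x)) has_derivative
      (\<lambda>w. p ** dmexp (transpose p ** x) (transpose p ** w))) (at x within tangent_space SO p)"
    by (intro bounded_linear.has_derivative[OF bounded_bilinear.bounded_linear_right[OF bounded_bilinear_matrix_mult]]
        has_derivative_compose[OF _ mexp_has_derivative] has_derivative_ident)
qed

text \<open>A derivative within the proper subspace \<open>tangent_space SO p\<close> is determined
  only in directions of that subspace, whence the hypothesis on \<open>w\<close>.\<close>

lemma d_exp_SO:
  fixes p :: "real ^ 'n ^ 'n"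
  assumes p: "p \<in> SO" and x: "x \<in> tangent_space SO p" and w: "w \<in> tangent_space SO p"
  shows "d_exp SO p x w = p ** dmexp (transpose p ** x) (transpose p ** w)"
  unfolding d_exp_def
  by (rule frechet_derivative_tangent[OF riem_exp_SO_has_derivative[OF p x]
        subspace_subset_tangent_space[OF subspace_tangent_space_SO[OF p] x w]])

text \<open>The product rule yields the second derivative of \<open>mexp\<close> plus
  \<open>d_exp\<close> of the flat derivative of \<open>W2\<close>. The latter is already tangent,
  survives the projection and cancels against the subtracted term. What remains depends only on the
  values of the fields at \<open>u\<close>.\<close>

lemma hess_exp_fields_SO:
  fixes p u :: "real ^ 'n ^ 'n"
  assumes p: "p \<in> SO"
    and U: "openin (top_of_set (tangent_space SO p)) U" "u \<in> U"
    and W1: "W1 u \<in> tangent_space SO p"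
    and W2: "W2 \<in> U \<rightarrow> tangent_space SO p" "W2 differentiable_on U"
  defines "A \<equiv> transpose p ** u"
  defines "P \<equiv> transpose (mexp A) ** d2mexp A (transpose p ** W1 u) (transpose p ** W2 u)"
  shows "hess_exp_fields SO p W1 W2 u = (1 / 2) *\<^sub>R (p ** mexp A ** (P - transpose P))"
proof -
  let ?N = "tangent_space SO p"
  let ?L = "\<lambda>x. transpose p ** x"
  define D where "D = frechet_derivative W2 (at u within ?N)"
  define K where "K = d2mexp A (?L (W1 u)) (?L (W2 u))"
  note N = subspace_tangent_space_SO[OF p]
  note mm_deriv = bounded_linear.has_derivative[OF bounded_bilinear.bounded_linear_right[OF bounded_bilinear_matrix_mult]]
  have UN: "U \<subseteq> ?N" using U(1) by (rule openin_imp_subset)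
  then have u: "u \<in> ?N" using U by blast
  have at: "at u within ?N = at u within U"
  proof -
    obtain T where "open T" "U = ?N \<inter> T" using U(1) by (auto simp: openin_open)
    then show ?thesis using U(2) by (intro at_within_nhd[of u T]) auto
  qed
  have w1: "W1 u \<in> tangent_space ?N u" by (rule subspace_subset_tangent_space[OF N u W1])
  have D: "(W2 has_derivative D) (at u within ?N)"
    using W2(2) U(2) unfolding D_def frechet_derivative_works[symmetric] at differentiable_on_def by blast
  \<comment> \<open>The linear equation defining the tangent space holds for \<open>W2\<close> on
    all of \<open>U\<close>, so differentiating it gives the same equation for
    \<open>D (W1 u)\<close>.\<close>
  have Dw: "D (W1 u) \<in> ?N"
  proof -
    let ?c = "\<lambda>v. ?L v + transpose v ** p"
    have "((\<lambda>x. ?c (W2 x)) has_derivative (\<lambda>h. ?c (D h))) (at u within ?N)"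
      by (intro has_derivative_add mm_deriv tr_has_derivative D
          bounded_linear.has_derivative[OF bounded_bilinear.bounded_linear_left[OF bounded_bilinear_matrix_mult]])
    from frechet_derivative_tangent[OF this w1]
    have 1: "frechet_derivative (\<lambda>x. ?c (W2 x)) (at u within ?N) (W1 u) = ?c (D (W1 u))" .
    have "((\<lambda>x. ?c (W2 x)) has_derivative (\<lambda>_. 0)) (at u within ?N)"
      unfolding at
      by (rule has_derivative_transform[OF U(2) _ has_derivative_const[of 0]])
         (use W2(1) tangent_space_SO[OF p] in blast)
    from frechet_derivative_tangent[OF this w1] 1 show ?thesis by (simp add: tangent_space_SO[OF p])
  qed
  have "((\<lambda>x. p ** dmexp (?L x) (?L (W2 x))) has_derivative
      (\<lambda>h. p ** (d2mexp A (?L h) (?L (W2 u)) + dmexp A (?L (D h))))) (at u within ?N)"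
    unfolding A_def by (intro mm_deriv dmexp_field_has_derivative has_derivative_ident D)
  then have "((\<lambda>x. d_exp SO p x (W2 x)) has_derivative
      (\<lambda>h. p ** (d2mexp A (?L h) (?L (W2 u)) + dmexp A (?L (D h))))) (at u within ?N)"
    unfolding at
    by (rule has_derivative_transform[OF U(2), rotated])
       (use UN W2(1) in \<open>auto intro!: d_exp_SO[OF p]\<close>)
  from frechet_derivative_tangent[OF this w1]
  have ds: "frechet_derivative (\<lambda>x. d_exp SO p x (W2 x)) (at u within ?N) (W1 u)
      = p ** K + d_exp SO p u (D (W1 u))"
    by (simp add: K_def mm_add_right d_exp_SO[OF p u Dw] A_def)
  have "mexp A \<in> SO"
    by (rule mexp_skew_in_SO) (use u tangent_space_SO_iff[OF p] A_def in blast)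
  \<comment> \<open>Writing \<open>K\<close> as \<open>mexp A ** P\<close> brings the vector into
    the form expected by \<open>orth_proj_SO\<close> at the point
    \<open>p ** mexp A\<close>.\<close>
  then have q: "p ** mexp A \<in> SO" and pK: "p ** K = p ** mexp A ** P"
    using SO_mult_transpose[of "mexp A"] p
    by (simp_all add: SO_mult P_def K_def matrix_mul_assoc) (metis matrix_mul_assoc matrix_mul_rid)
  have "riem_exp SO p \<in> ?N \<rightarrow> SO"
  proof
    fix x assume x: "x \<in> ?N"
    then have "mexp (?L x) \<in> SO" by (intro mexp_skew_in_SO) (use tangent_space_SO_iff[OF p] in blast)
    then show "riem_exp SO p x \<in> SO" by (simp add: riem_exp_SO[OF p x] SO_mult p)
  qed
  from tangent_space_map[OF riem_exp_SO_has_derivative[OF p u] this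
      subspace_subset_tangent_space[OF N u Dw]]
  have "d_exp SO p u (D (W1 u)) \<in> tangent_space SO (riem_exp SO p u)"
    by (simp add: d_exp_SO[OF p u Dw])
  moreover have "riem_exp SO p u = p ** mexp A" by (simp add: riem_exp_SO[OF p u] A_def)
  ultimately show ?thesis
    unfolding hess_exp_fields_def pullback_LC_def ds D_def[symmetric]
    by (simp add: orth_proj_add[OF subspace_tangent_space_SO[OF q]] pK orth_proj_SO[OF q])
qed

lemma hess_exp_SO:
  fixes p u w1 w2 :: "real ^ 'n ^ 'n"
  assumes p: "p \<in> SO" and u: "u \<in> tangent_space SO p"
    and w: "w1 \<in> tangent_space SO p" "w2 \<in> tangent_space SO p"
  defines "A \<equiv> transpose p ** u"
  defines "P \<equiv> transpose (mexp A) ** d2mexp A (transpose p ** w1) (transpose p ** w2)"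
  shows "hess_exp SO p u w1 w2 = (1 / 2) *\<^sub>R (p ** mexp A ** (P - transpose P))"
  unfolding hess_exp_def
proof (rule the_equality)
  show "\<forall>U W1 W2. openin (top_of_set (tangent_space SO p)) U \<and> u \<in> U
        \<and> W1 \<in> U \<rightarrow> tangent_space SO p \<and> W2 \<in> U \<rightarrow> tangent_space SO p
        \<and> W1 differentiable_on U \<and> W2 differentiable_on U \<and> W1 u = w1 \<and> W2 u = w2
      \<longrightarrow> hess_exp_fields SO p W1 W2 u = (1 / 2) *\<^sub>R (p ** mexp A ** (P - transpose P))"
    using hess_exp_fields_SO[OF p] w unfolding A_def P_def by blast
next
  fix h
  assume "\<forall>U W1 W2. openin (top_of_set (tangent_space SO p)) U \<and> u \<in> U
        \<and> W1 \<in> U \<rightarrow> tangent_space SO p \<and> W2 \<in> U \<rightarrow> tangent_space SO p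
        \<and> W1 differentiable_on U \<and> W2 differentiable_on U \<and> W1 u = w1 \<and> W2 u = w2
      \<longrightarrow> hess_exp_fields SO p W1 W2 u = h"
  \<comment> \<open>Constant fields on the whole tangent space are admissible extensions, so the
    universal condition is not vacuous and fixes \<open>h\<close>.\<close>
  from this[rule_format, of "tangent_space SO p" "\<lambda>_. w1" "\<lambda>_. w2"]
  have "hess_exp_fields SO p (\<lambda>_. w1) (\<lambda>_. w2) u = h" using u w by auto
  moreover have "hess_exp_fields SO p (\<lambda>_. w1) (\<lambda>_. w2) u = (1 / 2) *\<^sub>R (p ** mexp A ** (P - transpose P))"
    unfolding A_def P_def
    by (rule hess_exp_fields_SO[OF p, of "tangent_space SO p"]) (use u w in auto)
  ultimately show "h = (1 / 2) *\<^sub>R (p ** mexp A ** (P - transpose P))" by simp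
qed

theorem mainTheorem4:
  fixes p v w1 w2 :: "real ^ 'n ^ 'n" and r :: real
  assumes "CARD('n) > 2"
    and "p \<in> SO"
    and "v \<in> tangent_space SO p" and "norm v = 1"
    and "w1 \<in> tangent_space SO p" and "w2 \<in> tangent_space SO p"
    and "0 < r" and "r < 2 * sqrt 2 * pi"
  shows "norm (hess_exp SO p (r *\<^sub>R v) w1 w2) \<le> r / 3 * norm w1 * norm w2"
proof -
  note p = \<open>p \<in> SO\<close>
  define A where "A = transpose p ** (r *\<^sub>R v)"
  define P where "P = transpose (mexp A) ** d2mexp A (transpose p ** w1) (transpose p ** w2)"
  have u: "r *\<^sub>R v \<in> tangent_space SO p"
    by (rule subspace_scale[OF subspace_tangent_space_SO[OF p] \<open>v \<in> tangent_space SO p\<close>])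
  have n: "norm (transpose p ** x) = norm x" for x :: "real ^ 'n ^ 'n"
    using SO_mult_transpose[OF p] by (intro norm_mult_orthogonal) simp
  have A: "transpose A = - A" using u tangent_space_SO_iff[OF p] A_def by blast
  then have "p ** mexp A \<in> SO" by (intro SO_mult p mexp_skew_in_SO)
  \<comment> \<open>Left multiplication by the rotation \<open>p ** mexp A\<close> is an isometry
    and drops out of the norm.\<close>
  then have "norm (hess_exp SO p (r *\<^sub>R v) w1 w2) = 1 / 2 * norm (P - transpose P)"
    using assms by (simp add: hess_exp_SO[OF p u] A_def P_def SO_iff norm_mult_orthogonal)
  also have "\<dots> \<le> 1 / 2 * (2 / 3 * norm A * norm (transpose p ** w1) * norm (transpose p ** w2))"
    unfolding P_def using assms tangent_space_SO_iff[OF p]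
    by (intro mult_left_mono skew_part_d2mexp_bound A) auto
  \<comment> \<open>Translation by \<open>transpose p\<close> preserves norms, and
    \<open>norm A = r\<close> since \<open>v\<close> is a unit vector.\<close>
  also have "\<dots> = r / 3 * norm w1 * norm w2"
    unfolding n A_def using assms by simp
  finally show ?thesis .
qed

end
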